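(* Let $(X,\rho,\mu)$ be a $K$-doubling metric measure space, $(M,d)$ a complete metric space and $Q\ge1$ an integer. (a) If $\mathcal D$ is a differentiably complete $X$-distribution for $M$, then every function $f\colon X\to\mathcal A_Q(M)$ is a.e. $\mathcal D^Q$-differentiable on $A_f$. (b) If $\mathcal D$ is a differentiably complete approximate $X$-distribution for $M$, then every function $f\colon X\to\mathcal A_Q(M)$ is a.e. approximately $\mathcal D^Q$-differentiable on $A_f^\mu$.
   Context: A $K$-doubling metric measure space ($K>0$) is a triple $(X,\rho,\mu)$ where $(X,\rho)$ is a complete separable metric space and $\mu$ a Borel-regular outer measure with $0<\mu(B_{2r}(x))\le K\mu(B_r(x))<+\infty$. A set $E\ni x$ is a $\mu$-neighborhood of $x$ if there is a Borel $B\subseteq E$ with $\lim_{r\to0^+}\mu(B_r(x)\setminus B)/\mu(B_r(x))=0$; $\mu\text{-}\lim$, $\mu\text{-}\limsup$ are limits along $\mu$-neighborhoods ($\mu\text{-}\limsup_{y\in A,y\to x}g(y)=\inf_U\sup_{y\in U\cap A\setminus\{x\}}g(y)$), and $x$ is a $\mu$-accumulation point of $A$ if $A\cap U\setminus\{x\}\ne\emptyset$ for all $\mu$-neighborhoods $U$. $\mathcal A_Q(M)$ is the set of measures $\sum_{i=1}^Q[\![P_i]\!]$ with metric $\mathcal G(\sum_i[\![A_i]\!],\sum_i[\![B_i]\!])=\min_\sigma\sqrt{\sum_i d(A_i,B_{\sigma(i)})^2}$ over permutations $\sigma$. For a complete metric space $(N,e)$, germs at $(x,P)\in X\times N$ are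 classes $[F]$ of Lipschitz $F\colon B\to N$ with $F(x)=P$, where for an $X$-distribution $B$ is a metric neighborhood of $x$ and $F\sim G\iff\lim_{y\to x}e(F,G)/\rho(y,x)=0$, and for an approximate $X$-distribution $B$ is a $\mu$-neighborhood of $x$ and $F\sim G\iff\mu\text{-}\lim_{y\to x}e(F,G)/\rho(y,x)=0$; an (approximate) $X$-distribution $\mathcal E$ for $N$ is any set of such germs, $\mathcal E_{x,P}$ those at $(x,P)$. For $f\colon A\to N$: $f$ is $\mathcal E$-differentiable at an accumulation point $x\in A$ of $A$ if some $[F]\in\mathcal E_{x,f(x)}$ has $\lim_{y\in A,y\to x}e(f(y),F(y))/\rho(y,x)=0$; approximately $\mathcal E$-differentiable at a $\mu$-accumulation point $x\in A$ if the same holds with $\mu\text{-}\lim$. $A_f$ (resp. $A_f^\mu$) is the set of accumulation (resp. $\mu$-accumulation) points $x\in A$ with $\limsup$ (resp. $\mu\text{-}\limsup$) of $e(f(y),f(x))/\rho(y,x)$, $y\in A$, $y\to x$, finite. "a.e. (approximately) $\mathcal E$-differentiable on $A_f$ (resp. $A_f^\mu$)" means at $\mu$-a.e. point of every $\mu$-measurable subset. $\mathcal E$ is differentiably complete if for every nonempty closed $C\subseteq X$ and Lipschitz $g\colon C\to N$, $g$ is a.e. approximately $\mathcal E$-differentiable on $A_g^\mu$. $\mathcal D^Q$: for $\mathbf P=\sum_i[\![P_i]\!]$, $[\mathbf F]\in\mathcal D^Q_{x_0,\mathbf P}$ iff there exist $[F_i]\in\mathcal D_{x_0,P_i}$ with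 $\mathbf F(x)=\sum_{i=1}^Q[\![F_i(x)]\!]$ on a Borel neighborhood (a Borel $\mu$-neighborhood in the approximate case) of $x_0$, and $P_i=P_j\Rightarrow[F_i]=[F_j]$. *)

theory Defs
  imports "HOL-Analysis.Analysis" "HOL-Library.Multiset" "HOL-Combinatorics.Permutations"
begin

definition borel_regular_outer_measure :: "('x::metric_space set \<Rightarrow> ennreal) \<Rightarrow> bool" where
  "borel_regular_outer_measure \<mu> \<longleftrightarrow>
     outer_measure_space (Pow UNIV) \<mu>
   \<and> sets borel \<subseteq> lambda_system UNIV (Pow UNIV) \<mu>
   \<and> (\<forall>A. \<exists>B\<in>sets borel. A \<subseteq> B \<and> \<mu> B = \<mu> A)"

definition doubling_mms :: "real \<Rightarrow> ('x::polish_space set \<Rightarrow> ennreal) \<Rightarrow> bool" where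
  "doubling_mms K \<mu> \<longleftrightarrow> K > 0 \<and> borel_regular_outer_measure \<mu> \<and>
     (\<forall>x r. r > 0 \<longrightarrow> 0 < \<mu> (ball x (2 * r)) \<and> \<mu> (ball x (2 * r)) \<le> ennreal K * \<mu> (ball x r)
                     \<and> \<mu> (ball x r) < \<infinity>)"

definition mu_measurable :: "('x set \<Rightarrow> ennreal) \<Rightarrow> 'x set set" where
  "mu_measurable \<mu> = lambda_system UNIV (Pow UNIV) \<mu>"

definition ae_on :: "('x set \<Rightarrow> ennreal) \<Rightarrow> 'x set \<Rightarrow> ('x \<Rightarrow> bool) \<Rightarrow> bool" where
  "ae_on \<mu> A P \<longleftrightarrow> (\<forall>E. E \<subseteq> A \<longrightarrow> E \<in> mu_measurable \<mu> \<longrightarrow> \<mu> {x\<in>E. \<not> P x} = 0)"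

definition mu_nbhd :: "('x::metric_space set \<Rightarrow> ennreal) \<Rightarrow> 'x \<Rightarrow> 'x set \<Rightarrow> bool" where
  "mu_nbhd \<mu> x E \<longleftrightarrow> x \<in> E \<and> (\<exists>B\<in>sets borel. B \<subseteq> E \<and>
     ((\<lambda>r. enn2real (\<mu> (ball x r - B)) / enn2real (\<mu> (ball x r))) \<longlongrightarrow> 0) (at_right 0))"

definition mu_tendsto :: "('x::metric_space set \<Rightarrow> ennreal) \<Rightarrow> 'x \<Rightarrow> 'x set \<Rightarrow> ('x \<Rightarrow> real) \<Rightarrow> real \<Rightarrow> bool" where
  "mu_tendsto \<mu> x S g L \<longleftrightarrow>
     (\<forall>\<epsilon>>0. \<exists>U. mu_nbhd \<mu> x U \<and> (\<forall>y\<in>U \<inter> S - {x}. \<bar>g y - L\<bar> < \<epsilon>))"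

definition mu_limsup :: "('x::metric_space set \<Rightarrow> ennreal) \<Rightarrow> 'x \<Rightarrow> 'x set \<Rightarrow> ('x \<Rightarrow> ereal) \<Rightarrow> ereal" where
  "mu_limsup \<mu> x A g = (INF U\<in>{U. mu_nbhd \<mu> x U}. SUP y\<in>U \<inter> A - {x}. g y)"

definition mu_accum :: "('x::metric_space set \<Rightarrow> ennreal) \<Rightarrow> 'x set \<Rightarrow> 'x \<Rightarrow> bool" where
  "mu_accum \<mu> A x \<longleftrightarrow> (\<forall>U. mu_nbhd \<mu> x U \<longrightarrow> A \<inter> U - {x} \<noteq> {})"

text \<open>Target metric space (N, e) given by a carrier N and a distance e.\<close>

definition lip_into :: "'n set \<Rightarrow> ('n \<Rightarrow> 'n \<Rightarrow> real) \<Rightarrow> 'x::metric_space set \<Rightarrow> ('x \<Rightarrow> 'n) \<Rightarrow> bool" where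
  "lip_into N e B F \<longleftrightarrow> F ` B \<subseteq> N \<and> (\<exists>L. \<forall>y\<in>B. \<forall>z\<in>B. e (F y) (F z) \<le> L * dist y z)"

definition germ_rep :: "'n set \<Rightarrow> ('n \<Rightarrow> 'n \<Rightarrow> real) \<Rightarrow> 'x::metric_space \<Rightarrow> 'n \<Rightarrow> 'x set \<Rightarrow> ('x \<Rightarrow> 'n) \<Rightarrow> bool" where
  "germ_rep N e x P B F \<longleftrightarrow> (\<exists>r>0. ball x r \<subseteq> B) \<and> lip_into N e B F \<and> F x = P"

definition germ_equiv :: "('n \<Rightarrow> 'n \<Rightarrow> real) \<Rightarrow> 'x::metric_space \<Rightarrow> 'x set \<Rightarrow> ('x \<Rightarrow> 'n) \<Rightarrow> 'x set \<Rightarrow> ('x \<Rightarrow> 'n) \<Rightarrow> bool" where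
  "germ_equiv e x B F B' G \<longleftrightarrow> ((\<lambda>y. e (F y) (G y) / dist y x) \<longlongrightarrow> 0) (at x within B \<inter> B')"

definition germ_class :: "'n set \<Rightarrow> ('n \<Rightarrow> 'n \<Rightarrow> real) \<Rightarrow> 'x::metric_space \<Rightarrow> 'n \<Rightarrow> 'x set \<Rightarrow> ('x \<Rightarrow> 'n) \<Rightarrow> ('x set \<times> ('x \<Rightarrow> 'n)) set" where
  "germ_class N e x P B F = {(B', G). germ_rep N e x P B' G \<and> germ_equiv e x B F B' G}"

text \<open>An X-distribution is a set of germs; a germ at (x,P) is recorded as a triple (x, P, class).\<close>
definition X_distribution :: "'n set \<Rightarrow> ('n \<Rightarrow> 'n \<Rightarrow> real) \<Rightarrow> ('x::metric_space \<times> 'n \<times> ('x set \<times> ('x \<Rightarrow> 'n)) set) set \<Rightarrow> bool" where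
  "X_distribution N e E \<longleftrightarrow>
     (\<forall>(x, P, \<Gamma>)\<in>E. \<exists>B F. germ_rep N e x P B F \<and> \<Gamma> = germ_class N e x P B F)"

definition agerm_rep :: "('x::metric_space set \<Rightarrow> ennreal) \<Rightarrow> 'n set \<Rightarrow> ('n \<Rightarrow> 'n \<Rightarrow> real) \<Rightarrow> 'x \<Rightarrow> 'n \<Rightarrow> 'x set \<Rightarrow> ('x \<Rightarrow> 'n) \<Rightarrow> bool" where
  "agerm_rep \<mu> N e x P B F \<longleftrightarrow> mu_nbhd \<mu> x B \<and> lip_into N e B F \<and> F x = P"

definition agerm_equiv :: "('x::metric_space set \<Rightarrow> ennreal) \<Rightarrow> ('n \<Rightarrow> 'n \<Rightarrow> real) \<Rightarrow> 'x \<Rightarrow> 'x set \<Rightarrow> ('x \<Rightarrow> 'n) \<Rightarrow> 'x set \<Rightarrow> ('x \<Rightarrow> 'n) \<Rightarrow> bool" where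
  "agerm_equiv \<mu> e x B F B' G \<longleftrightarrow> mu_tendsto \<mu> x (B \<inter> B') (\<lambda>y. e (F y) (G y) / dist y x) 0"

definition agerm_class :: "('x::metric_space set \<Rightarrow> ennreal) \<Rightarrow> 'n set \<Rightarrow> ('n \<Rightarrow> 'n \<Rightarrow> real) \<Rightarrow> 'x \<Rightarrow> 'n \<Rightarrow> 'x set \<Rightarrow> ('x \<Rightarrow> 'n) \<Rightarrow> ('x set \<times> ('x \<Rightarrow> 'n)) set" where
  "agerm_class \<mu> N e x P B F = {(B', G). agerm_rep \<mu> N e x P B' G \<and> agerm_equiv \<mu> e x B F B' G}"

definition approx_X_distribution :: "('x::metric_space set \<Rightarrow> ennreal) \<Rightarrow> 'n set \<Rightarrow> ('n \<Rightarrow> 'n \<Rightarrow> real) \<Rightarrow> ('x \<times> 'n \<times> ('x set \<times> ('x \<Rightarrow> 'n)) set) set \<Rightarrow> bool" where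
  "approx_X_distribution \<mu> N e E \<longleftrightarrow>
     (\<forall>(x, P, \<Gamma>)\<in>E. \<exists>B F. agerm_rep \<mu> N e x P B F \<and> \<Gamma> = agerm_class \<mu> N e x P B F)"

definition E_differentiable :: "('x::metric_space \<times> 'n \<times> ('x set \<times> ('x \<Rightarrow> 'n)) set) set \<Rightarrow> ('n \<Rightarrow> 'n \<Rightarrow> real) \<Rightarrow> 'x set \<Rightarrow> ('x \<Rightarrow> 'n) \<Rightarrow> 'x \<Rightarrow> bool" where
  "E_differentiable E e A f x \<longleftrightarrow> x \<in> A \<and> x islimpt A \<and>
     (\<exists>\<Gamma>. (x, f x, \<Gamma>) \<in> E \<and> (\<exists>(B, F)\<in>\<Gamma>.
        ((\<lambda>y. e (f y) (F y) / dist y x) \<longlongrightarrow> 0) (at x within A \<inter> B)))"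

definition approx_E_differentiable :: "('x::metric_space set \<Rightarrow> ennreal) \<Rightarrow> ('x \<times> 'n \<times> ('x set \<times> ('x \<Rightarrow> 'n)) set) set \<Rightarrow> ('n \<Rightarrow> 'n \<Rightarrow> real) \<Rightarrow> 'x set \<Rightarrow> ('x \<Rightarrow> 'n) \<Rightarrow> 'x \<Rightarrow> bool" where
  "approx_E_differentiable \<mu> E e A f x \<longleftrightarrow> x \<in> A \<and> mu_accum \<mu> A x \<and>
     (\<exists>\<Gamma>. (x, f x, \<Gamma>) \<in> E \<and> (\<exists>(B, F)\<in>\<Gamma>.
        mu_tendsto \<mu> x (A \<inter> B) (\<lambda>y. e (f y) (F y) / dist y x) 0))"

definition A_set :: "('n \<Rightarrow> 'n \<Rightarrow> real) \<Rightarrow> 'x::metric_space set \<Rightarrow> ('x \<Rightarrow> 'n) \<Rightarrow> 'x set" where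
  "A_set e A f = {x\<in>A. x islimpt A \<and>
     \<bar>Limsup (at x within A) (\<lambda>y. ereal (e (f y) (f x) / dist y x))\<bar> \<noteq> \<infinity>}"

definition A_set_mu :: "('x::metric_space set \<Rightarrow> ennreal) \<Rightarrow> ('n \<Rightarrow> 'n \<Rightarrow> real) \<Rightarrow> 'x set \<Rightarrow> ('x \<Rightarrow> 'n) \<Rightarrow> 'x set" where
  "A_set_mu \<mu> e A f = {x\<in>A. mu_accum \<mu> A x \<and>
     \<bar>mu_limsup \<mu> x A (\<lambda>y. ereal (e (f y) (f x) / dist y x))\<bar> \<noteq> \<infinity>}"

text \<open>Differentiable completeness of a (possibly approximate) X-distribution D for M.\<close>
definition differentiably_complete :: "('x::metric_space set \<Rightarrow> ennreal) \<Rightarrow> ('x \<times> 'm::metric_space \<times> ('x set \<times> ('x \<Rightarrow> 'm)) set) set \<Rightarrow> bool" where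
  "differentiably_complete \<mu> D \<longleftrightarrow>
     (\<forall>C g. C \<noteq> {} \<longrightarrow> closed C \<longrightarrow> (\<exists>L. L-lipschitz_on C g) \<longrightarrow>
        ae_on \<mu> (A_set_mu \<mu> dist C g) (approx_E_differentiable \<mu> D dist C g))"

definition AQ :: "nat \<Rightarrow> 'm multiset set" where
  "AQ Q = {S. size S = Q}"

definition Gdist :: "'m::metric_space multiset \<Rightarrow> 'm multiset \<Rightarrow> real" where
  "Gdist S T = Min {sqrt (\<Sum>i<size S. (dist (as ! i) (bs ! (\<sigma> i)))\<^sup>2) | as bs \<sigma>.
      mset as = S \<and> mset bs = T \<and> \<sigma> permutes {..<size S}}"

definition DQ :: "nat \<Rightarrow> ('x::metric_space \<times> 'm::metric_space \<times> ('x set \<times> ('x \<Rightarrow> 'm)) set) set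
    \<Rightarrow> ('x \<times> 'm multiset \<times> ('x set \<times> ('x \<Rightarrow> 'm multiset)) set) set" where
  "DQ Q D = {(x0, PP, \<Gamma>). (\<exists>B FF. germ_rep (AQ Q) Gdist x0 PP B FF \<and> \<Gamma> = germ_class (AQ Q) Gdist x0 PP B FF) \<and>
     (\<exists>(B, FF)\<in>\<Gamma>. \<exists>P \<Gamma>s Bs Fs W.
        PP = (\<Sum>i<Q. {# P i #}) \<and>
        (\<forall>i<Q. (x0, P i, \<Gamma>s i) \<in> D \<and> (Bs i, Fs i) \<in> \<Gamma>s i) \<and>
        (\<forall>i<Q. \<forall>j<Q. P i = P j \<longrightarrow> \<Gamma>s i = \<Gamma>s j) \<and>
        W \<in> sets borel \<and> (\<exists>r>0. ball x0 r \<subseteq> W) \<and> W \<subseteq> B \<and> (\<forall>i<Q. W \<subseteq> Bs i) \<and>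
        (\<forall>x\<in>W. FF x = (\<Sum>i<Q. {# Fs i x #})))}"

definition DQ_approx :: "('x::metric_space set \<Rightarrow> ennreal) \<Rightarrow> nat \<Rightarrow> ('x \<times> 'm::metric_space \<times> ('x set \<times> ('x \<Rightarrow> 'm)) set) set
    \<Rightarrow> ('x \<times> 'm multiset \<times> ('x set \<times> ('x \<Rightarrow> 'm multiset)) set) set" where
  "DQ_approx \<mu> Q D = {(x0, PP, \<Gamma>). (\<exists>B FF. agerm_rep \<mu> (AQ Q) Gdist x0 PP B FF \<and> \<Gamma> = agerm_class \<mu> (AQ Q) Gdist x0 PP B FF) \<and>
     (\<exists>(B, FF)\<in>\<Gamma>. \<exists>P \<Gamma>s Bs Fs W.
        PP = (\<Sum>i<Q. {# P i #}) \<and>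
        (\<forall>i<Q. (x0, P i, \<Gamma>s i) \<in> D \<and> (Bs i, Fs i) \<in> \<Gamma>s i) \<and>
        (\<forall>i<Q. \<forall>j<Q. P i = P j \<longrightarrow> \<Gamma>s i = \<Gamma>s j) \<and>
        W \<in> sets borel \<and> mu_nbhd \<mu> x0 W \<and> W \<subseteq> B \<and> (\<forall>i<Q. W \<subseteq> Bs i) \<and>
        (\<forall>x\<in>W. FF x = (\<Sum>i<Q. {# Fs i x #})))}"

end

theory Submission
  imports Defs
begin

text \<open>
  The proof splits \<open>f\<close> into branches and differentiates each branch. On a closed set where \<open>f\<close> is
  Lipschitz, the points at which distinct values of \<open>f x\<close> are at least \<open>1/n\<close> apart form a closed
  set, and on small pieces of it \<open>f\<close> is a sum of \<open>Q\<close> Lipschitz functions any two of which agree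
  everywhere or nowhere; differentiable completeness applies to each of them, and at density points
  of the piece the resulting germs add up to a germ of \<open>\<D>\<^sup>Q\<close>. Both parts reduce to this
  case: the points with a finite upper slope are covered, up to a null set, by countably many
  closed sets on which \<open>f\<close> is Lipschitz. In (b) this needs no measurability of \<open>f\<close>, since the
  restriction of \<open>f\<close> to \<open>A_f\<close> extends a uniform Lipschitz bound from a set to its closure. In (a) the
  approximate differentiability becomes full differentiability because in a doubling space a
  \<open>\<mu>\<close>-neighbourhood of \<open>x\<close> passes within \<open>o(dist y x)\<close> of every \<open>y\<close>.
\<close>

section \<open>Sums of points and their distance\<close>

text \<open>The points of an unordered sum carry no labels, and matchings chosen separately at each
  \<open>x\<close> need not combine to Lipschitz branches. A labelling becomes unambiguous, up to
  points that coincide, once the matching distance is small against the gap between distinct values;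
  this is the reason for fixing the gap on each piece.

  That two branches agree everywhere or nowhere on a piece serves the clause
  \<open>P i = P j --> \<Gamma> i = \<Gamma> j\<close> of \<open>DQ\<close> and
  \<open>DQ_approx\<close>. Differentiability supplies some germ for each branch, with no relation
  between the choices. Branches that coincide at \<open>x\<close> may be handed the same germ
  because they coincide on the whole piece.

  Differentiable completeness gives information only along the closed domain of a branch. The
  Lebesgue density theorem carries it over to the space: almost every point of a closed piece has
  that piece as a \<open>\<mu>\<close>-neighbourhood, so a \<open>\<mu>\<close>-limit along the
  piece is a \<open>\<mu>\<close>-limit along all of \<open>X\<close>. The density theorem itself
  comes from doubling through a Vitali covering argument.\<close>

abbreviation msum :: "nat \<Rightarrow> (nat \<Rightarrow> 'm) \<Rightarrow> 'm multiset" where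
  "msum Q a \<equiv> (\<Sum>i<Q. {# a i #})"

lemma sum_single_mset: "(\<Sum>i\<in>A. {# a i #}) = image_mset a (mset_set A)"
  by (induction A rule: infinite_finite_induct) auto

lemma msum_eq_mset: "msum Q a = mset (map a [0..<Q])"
  by (simp add: sum_single_mset mset_upt lessThan_atLeast0)

lemma size_msum [simp]: "size (msum Q a) = Q"
  by (simp add: sum_single_mset)

lemma set_mset_msum: "set_mset (msum Q a) = a ` {..<Q}"
  by (simp add: sum_single_mset)

lemma msum_in_AQ: "msum Q a \<in> AQ Q"
  by (simp add: AQ_def)

lemma msum_cong: "(\<And>i. i < Q \<Longrightarrow> a i = b i) \<Longrightarrow> msum Q a = msum Q b"
  by (rule sum.cong) auto

lemma msum_permute: "p permutes {..<Q} \<Longrightarrow> msum Q (\<lambda>i. a (p i)) = msum Q a"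
  using sum.permute[of p "{..<Q}" "\<lambda>i. {# a i #}"] by (simp add: o_def)

lemma AQ_enum: assumes "S \<in> AQ Q" obtains a where "S = msum Q a"
proof -
  obtain xs where xs: "mset xs = S" using ex_mset by blast
  then have "length xs = Q" using assms by (auto simp: AQ_def)
  then have "S = msum Q (\<lambda>i. xs ! i)" unfolding msum_eq_mset using xs map_nth[of xs] by simp
  then show ?thesis by (rule that)
qed

lemma L2_set_permute: "p permutes A \<Longrightarrow> L2_set (\<lambda>i. g (p i)) A = L2_set g A"
  using sum.permute[of p A "\<lambda>i. (g i)\<^sup>2"] by (simp add: L2_set_def o_def)

lemma finite_mset_eq: "finite {xs. mset xs = S}"
proof (rule finite_subset)
  show "{xs. mset xs = S} \<subseteq> {xs. set xs \<subseteq> set_mset S \<and> length xs = size S}" by auto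
  show "finite {xs. set xs \<subseteq> set_mset S \<and> length xs = size S}" by (intro finite_lists_length_eq) auto
qed

text \<open>\<open>Min\<close> is meaningful only on a finite nonempty set. A multiset has finitely
  many enumerations, and there are finitely many permutations.\<close>

lemma finite_Gdist_set:
  "finite {sqrt (\<Sum>i<size S. (dist (as ! i) (bs ! (\<sigma> i)))\<^sup>2) | as bs \<sigma>.
      mset as = S \<and> mset bs = T \<and> \<sigma> permutes {..<size S}}" (is "finite ?A")
proof (rule finite_subset)
  show "?A \<subseteq> (\<lambda>(as, bs, \<sigma>). sqrt (\<Sum>i<size S. (dist (as ! i) (bs ! (\<sigma> i)))\<^sup>2)) `
     ({as. mset as = S} \<times> {bs. mset bs = T} \<times> {\<sigma>. \<sigma> permutes {..<size S}})"
    by (rule subsetI) (auto intro!: image_eqI)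
  show "finite \<dots>"
    by (intro finite_imageI finite_cartesian_product finite_mset_eq finite_permutations) auto
qed

lemma Gdist_le:
  "Gdist (msum Q a) (msum Q b) \<le> L2_set (\<lambda>i. dist (a i) (b i)) {..<Q}"
  unfolding Gdist_def
proof (rule Min_le[OF finite_Gdist_set])
  have "L2_set (\<lambda>i. dist (a i) (b i)) {..<Q} =
      sqrt (\<Sum>i<size (msum Q a). (dist (map a [0..<Q] ! i) (map b [0..<Q] ! (id i)))\<^sup>2)"
    unfolding L2_set_def by (simp cong: sum.cong_simp)
  then show "L2_set (\<lambda>i. dist (a i) (b i)) {..<Q} \<in> {sqrt (\<Sum>i<size (msum Q a). (dist (as ! i) (bs ! (\<sigma> i)))\<^sup>2) | as bs \<sigma>.
      mset as = msum Q a \<and> mset bs = msum Q b \<and> \<sigma> permutes {..<size (msum Q a)}}"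
    by (intro CollectI exI[of _ "map a [0..<Q]"] exI[of _ "map b [0..<Q]"] exI[of _ id] conjI permutes_id)
       (simp_all only: msum_eq_mset)
qed

text \<open>An optimal pair of lists enumerates \<open>S\<close> in its own order, which differs
  from \<open>a\<close> by a permutation; moving that permutation to the other list lets any
  enumeration of \<open>S\<close> be prescribed. Optimal matchings can thus be chained with no
  permutation left in sight.\<close>

lemma Gdist_attained:
  assumes S: "S = msum Q a" and T: "T \<in> AQ Q"
  obtains b where "T = msum Q b" "Gdist S T = L2_set (\<lambda>i. dist (a i) (b i)) {..<Q}"
proof -
  let ?A = "{sqrt (\<Sum>i<size S. (dist (as ! i) (bs ! (\<sigma> i)))\<^sup>2) | as bs \<sigma>.
      mset as = S \<and> mset bs = T \<and> \<sigma> permutes {..<size S}}"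
  have sz: "size S = Q" "size T = Q" using S T by (auto simp: AQ_def)
  obtain as0 bs0 where "mset as0 = S" "mset bs0 = T" using ex_mset by metis
  then have "?A \<noteq> {}" using permutes_id by blast
  then have "Gdist S T \<in> ?A" unfolding Gdist_def by (rule Min_in[OF finite_Gdist_set])
  then obtain as bs \<sigma> where as: "mset as = S" and bs: "mset bs = T" and \<sigma>: "\<sigma> permutes {..<Q}"
    and G: "Gdist S T = sqrt (\<Sum>i<Q. (dist (as ! i) (bs ! (\<sigma> i)))\<^sup>2)" using sz by auto
  have len: "length as = Q" "length bs = Q" using as bs sz by auto
  have "msum Q a = msum Q (\<lambda>i. as ! i)"
    unfolding msum_eq_mset[of "\<lambda>i. as ! i"] using S as map_nth[of as] len by simp
  then obtain p where p: "p permutes {..<Q}" "\<forall>i\<in>{..<Q}. a i = as ! (p i)"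
    unfolding sum_single_mset by (rule image_mset_eq_implies_permutes[rotated]) auto
  show ?thesis
  proof (rule that)
    have "T = msum Q (\<lambda>i. bs ! i)"
      unfolding msum_eq_mset using bs map_nth[of bs] len by simp
    also have "\<dots> = msum Q (\<lambda>i. bs ! \<sigma> i)" using msum_permute[OF \<sigma>, of "\<lambda>i. bs ! i"] by simp
    also have "\<dots> = msum Q (\<lambda>i. bs ! \<sigma> (p i))" using msum_permute[OF p(1), of "\<lambda>i. bs ! \<sigma> i"] by simp
    finally show "T = msum Q (\<lambda>i. bs ! \<sigma> (p i))" .
    have "Gdist S T = L2_set (\<lambda>i. dist (as ! i) (bs ! \<sigma> i)) {..<Q}" unfolding G L2_set_def ..
    also have "\<dots> = L2_set (\<lambda>i. dist (as ! p i) (bs ! \<sigma> (p i))) {..<Q}"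
      using L2_set_permute[OF p(1), of "\<lambda>i. dist (as ! i) (bs ! \<sigma> i)"] by simp
    also have "\<dots> = L2_set (\<lambda>i. dist (a i) (bs ! \<sigma> (p i))) {..<Q}"
      using p(2) by (intro L2_set_cong) auto
    finally show "Gdist S T = L2_set (\<lambda>i. dist (a i) (bs ! \<sigma> (p i))) {..<Q}" .
  qed
qed

lemma Gdist_match:
  assumes "S = msum Q a" "T \<in> AQ Q"
  obtains b where "T = msum Q b" "\<And>i. i < Q \<Longrightarrow> dist (a i) (b i) \<le> Gdist S T"
proof -
  obtain b where b: "T = msum Q b" "Gdist S T = L2_set (\<lambda>i. dist (a i) (b i)) {..<Q}"
    using Gdist_attained[OF assms] by blast
  show ?thesis
    by (rule that[OF b(1)]) (auto simp: b(2) intro: member_le_L2_set[of "{..<Q}" _ "\<lambda>i. dist (a i) (b i)"])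
qed

lemma Gdist_le_sum: "Gdist (msum Q a) (msum Q b) \<le> (\<Sum>i<Q. dist (a i) (b i))"
  by (rule order_trans[OF Gdist_le L2_set_le_sum]) auto

lemma Gdist_nonneg: "S \<in> AQ Q \<Longrightarrow> T \<in> AQ Q \<Longrightarrow> 0 \<le> Gdist S T"
proof -
  assume S: "S \<in> AQ Q" and T: "T \<in> AQ Q"
  obtain a where a: "S = msum Q a" using S by (rule AQ_enum)
  show "0 \<le> Gdist S T" by (rule Gdist_attained[OF a T]) simp
qed

lemma Gdist_refl [simp]: "Gdist S S = 0"
proof -
  have S: "S \<in> AQ (size S)" by (simp add: AQ_def)
  then obtain a where a: "S = msum (size S) a" by (rule AQ_enum)
  have "Gdist (msum (size S) a) (msum (size S) a) \<le> 0" using Gdist_le_sum[of a "size S" a] by simp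
  then show ?thesis using Gdist_nonneg[OF S S] a by simp
qed

lemma Gdist_commute: assumes "S \<in> AQ Q" "T \<in> AQ Q" shows "Gdist S T = Gdist T S"
proof -
  have "Gdist T S \<le> Gdist S T" if ST: "S \<in> AQ Q" "T \<in> AQ Q" for S T :: "'a multiset"
  proof -
    obtain a where a: "S = msum Q a" using ST(1) by (rule AQ_enum)
    obtain b where b: "T = msum Q b" "Gdist S T = L2_set (\<lambda>i. dist (a i) (b i)) {..<Q}"
      using Gdist_attained[OF a ST(2)] by blast
    have "Gdist T S \<le> L2_set (\<lambda>i. dist (b i) (a i)) {..<Q}" unfolding a b(1) by (rule Gdist_le)
    also have "\<dots> = Gdist S T" unfolding b(2) by (simp add: dist_commute)
    finally show ?thesis .
  qed
  then show ?thesis using assms by (simp add: antisym)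
qed

text \<open>Two optimal matchings are chained through a common enumeration of \<open>S\<close>; the
  rest is the Minkowski inequality.\<close>

lemma Gdist_triangle:
  assumes "R \<in> AQ Q" "S \<in> AQ Q" "T \<in> AQ Q"
  shows "Gdist R T \<le> Gdist R S + Gdist S T"
proof -
  obtain a where a: "R = msum Q a" using assms(1) by (rule AQ_enum)
  obtain b where b: "S = msum Q b" "Gdist R S = L2_set (\<lambda>i. dist (a i) (b i)) {..<Q}"
    using Gdist_attained[OF a assms(2)] by blast
  obtain c where c: "T = msum Q c" "Gdist S T = L2_set (\<lambda>i. dist (b i) (c i)) {..<Q}"
    using Gdist_attained[OF b(1) assms(3)] by blast
  have "Gdist R T \<le> L2_set (\<lambda>i. dist (a i) (c i)) {..<Q}" unfolding a c(1) by (rule Gdist_le)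
  also have "\<dots> \<le> L2_set (\<lambda>i. dist (a i) (b i) + dist (b i) (c i)) {..<Q}"
    by (intro L2_set_mono dist_triangle) auto
  also have "\<dots> \<le> Gdist R S + Gdist S T" unfolding b(2) c(2) by (rule L2_set_triangle_ineq)
  finally show ?thesis .
qed

section \<open>Gaps between distinct values and the selection of Lipschitz branches\<close>

definition separated :: "real \<Rightarrow> 'm::metric_space multiset \<Rightarrow> bool" where
  "separated s S \<longleftrightarrow> (\<forall>p\<in>#S. \<forall>q\<in>#S. p \<noteq> q \<longrightarrow> s \<le> dist p q)"

lemma ex_separated: "\<exists>n. separated (inverse (real (Suc n))) S"
proof -
  define A where "A = (\<lambda>(p, q). dist p q) ` {(p, q) \<in> set_mset S \<times> set_mset S. p \<noteq> q}"
  have fin: "finite A" unfolding A_def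
    by (intro finite_imageI finite_subset[OF _ finite_cartesian_product[of "set_mset S" "set_mset S"]]) auto
  have pos: "\<And>d. d \<in> A \<Longrightarrow> d > 0" by (auto simp: A_def)
  have "Min (insert 1 A) > 0" using fin pos by auto
  then obtain n where n: "inverse (real (Suc n)) < Min (insert 1 A)" using reals_Archimedean by blast
  have "inverse (real (Suc n)) \<le> d" if "d \<in> A" for d
    using n fin that by (auto intro: less_imp_le)
  then show ?thesis unfolding separated_def A_def by (intro exI[of _ n]) fastforce
qed

text \<open>Distinct points \<open>p\<close>, \<open>q\<close> of the limit value are matched with
  points of \<open>f (X n)\<close> that are still distinct once the matching error is below half of
  \<open>dist p q\<close>. Those are at least \<open>s\<close> apart, and the bound passes to the
  limit.\<close>

lemma closed_separated:
  fixes f :: "'x::metric_space \<Rightarrow> 'm::metric_space multiset"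
  assumes C: "closed C" and f: "\<And>x. f x \<in> AQ Q" and L: "L \<ge> 0" and s: "s > 0"
    and lip: "\<And>x y. x \<in> C \<Longrightarrow> y \<in> C \<Longrightarrow> Gdist (f x) (f y) \<le> L * dist x y"
  shows "closed {x \<in> C. separated s (f x)}"
  unfolding closed_sequential_limits
proof (intro allI impI, elim conjE)
  fix X x assume X: "\<forall>n. X n \<in> {x \<in> C. separated s (f x)}" and lim: "X \<longlonglongrightarrow> x"
  have x: "x \<in> C" using C X lim unfolding closed_sequential_limits by blast
  have "s \<le> dist p q" if p: "p \<in># f x" and q: "q \<in># f x" and pq: "p \<noteq> q" for p q
  proof -
    obtain a where a: "f x = msum Q a" using f AQ_enum by metis
    obtain i j where ij: "i < Q" "p = a i" "j < Q" "q = a j" using p q by (auto simp: a set_mset_msum)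
    have lim0: "(\<lambda>n. 2 * (L * dist x (X n))) \<longlonglongrightarrow> 2 * (L * dist x x)"
      using lim by (intro tendsto_intros)
    then have lim1: "(\<lambda>n. dist p q + 2 * (L * dist x (X n))) \<longlonglongrightarrow> dist p q + 2 * (L * dist x x)"
      by (intro tendsto_add tendsto_const)
    have "2 * (L * dist x x) < dist p q" using pq by simp
    from order_tendstoD(2)[OF lim0 this]
    have "\<forall>\<^sub>F n in sequentially. 2 * (L * dist x (X n)) < dist p q" .
    then have "\<forall>\<^sub>F n in sequentially. s \<le> dist p q + 2 * (L * dist x (X n))"
    proof eventually_elim
      case (elim n)
      have Xn: "X n \<in> C" "separated s (f (X n))" using X by auto
      obtain b where b: "f (X n) = msum Q b" "\<And>i. i < Q \<Longrightarrow> dist (a i) (b i) \<le> Gdist (f x) (f (X n))"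
        using Gdist_match[OF a f] by blast
      have d: "dist (a i) (b i) \<le> L * dist x (X n)" "dist (a j) (b j) \<le> L * dist x (X n)"
        using b(2) ij lip[OF x Xn(1)] order_trans by blast+
      have "b i \<noteq> b j"
        using elim d dist_triangle2[of "a i" "a j" "b i"] ij by auto
      then have "s \<le> dist (b i) (b j)" using Xn(2) ij by (auto simp: separated_def b(1) set_mset_msum)
      also have "\<dots> \<le> dist (b i) (a i) + dist (a i) (a j) + dist (a j) (b j)"
        using dist_triangle[of "b i" "b j" "a i"] dist_triangle[of "a i" "b j" "a j"] by linarith
      finally show ?case using d ij by (simp add: dist_commute)
    qed
    then have "s \<le> dist p q + 2 * (L * dist x x)"
      using lim1 by (intro tendsto_lowerbound[OF lim1]) auto
    then show ?thesis by simp
  qed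
  then show "x \<in> {x \<in> C. separated s (f x)}" using x by (simp add: separated_def)
qed

text \<open>Matching every value against one fixed value \<open>f x0\<close> selects the branches.\<close>
lemma selection_piece:
  fixes f :: "'x::metric_space \<Rightarrow> 'm::metric_space multiset"
  assumes f: "\<And>x. f x \<in> AQ Q" and L: "L \<ge> 0"
    and lip: "\<And>x y. x \<in> C \<Longrightarrow> y \<in> C \<Longrightarrow> Gdist (f x) (f y) \<le> L * dist x y"
    and sep: "\<And>x. x \<in> C \<Longrightarrow> separated s (f x)"
    and small: "\<And>x y. x \<in> C \<Longrightarrow> y \<in> C \<Longrightarrow> L * dist x y < s / 4"
  shows "\<exists>g. (\<forall>y\<in>C. f y = msum Q (\<lambda>i. g i y)) \<and> (\<forall>i<Q. L-lipschitz_on C (g i)) \<and>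
    (\<forall>i<Q. \<forall>j<Q. \<forall>x\<in>C. \<forall>y\<in>C. g i x = g j x \<longrightarrow> g i y = g j y)"
proof (cases "C = {}")
  case False
  then obtain x0 where x0: "x0 \<in> C" by blast
  obtain P where P: "f x0 = msum Q P" using f AQ_enum by metis
  have "\<exists>b. f y = msum Q b \<and> (\<forall>i<Q. dist (P i) (b i) < s / 4)" if y: "y \<in> C" for y
  proof -
    obtain b where "f y = msum Q b" "\<And>i. i < Q \<Longrightarrow> dist (P i) (b i) \<le> Gdist (f x0) (f y)"
      using Gdist_match[OF P f] by blast
    then show ?thesis using lip[OF x0 y] small[OF x0 y] by (meson le_less_trans order_trans)
  qed
  then obtain h where h: "\<And>y. y \<in> C \<Longrightarrow> f y = msum Q (h y)"
    "\<And>y i. y \<in> C \<Longrightarrow> i < Q \<Longrightarrow> dist (P i) (h y i) < s / 4" by metis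
  have hmem: "h y i \<in># f y" if "y \<in> C" "i < Q" for y i
    using h(1)[OF that(1)] that(2) by (auto simp: set_mset_msum)
  have sepP: "P i = P j" if "dist (P i) (P j) < s" "i < Q" "j < Q" for i j
    using sep[OF x0] that unfolding separated_def P set_mset_msum by force
  have eq: "h y i = h y j" if "y \<in> C" "i < Q" "j < Q" "dist (h y i) (h y j) < s" for i j y
    using sep[OF that(1)] hmem that unfolding separated_def by (meson not_le)
  \<comment> \<open>Coincidence of two branches can be read off at \<open>x0\<close>: passing
    between \<open>P\<close> and \<open>h y\<close> costs less than \<open>s / 4\<close> at each
    end, and distinct points of one value are at least \<open>s\<close> apart.\<close>
  have hP: "h y i = h y j \<longleftrightarrow> P i = P j" if "y \<in> C" "i < Q" "j < Q" for i j y
  proof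
    assume hh: "h y i = h y j"
    have "dist (P i) (P j) < s"
      using h(2)[OF that(1,2)] h(2)[OF that(1,3), folded hh] dist_triangle2[of "P i" "P j" "h y i"]
        zero_le_dist[of "P i" "h y i"] by linarith
    then show "P i = P j" using sepP that by blast
  next
    assume PP: "P i = P j"
    have "dist (h y i) (h y j) < s"
      using h(2)[OF that(1,2)] h(2)[OF that(1,3), folded PP] dist_triangle3[of "h y i" "h y j" "P i"]
        zero_le_dist[of "P i" "h y i"] by linarith
    then show "h y i = h y j" using eq that by blast
  qed
  \<comment> \<open>An optimal matching of \<open>f y\<close> with \<open>f z\<close> may send
    branch \<open>i\<close> to another branch \<open>j\<close>. Three errors below
    \<open>s / 4\<close> then force \<open>P i = P j\<close>, so the branches \<open>i\<close> and
    \<open>j\<close> coincide and no harm is done.\<close>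
  have lip_h: "dist (h y i) (h z i) \<le> L * dist y z" if yz: "y \<in> C" "z \<in> C" and i: "i < Q" for y z i
  proof -
    obtain b where b: "f z = msum Q b" "\<And>i. i < Q \<Longrightarrow> dist (h y i) (b i) \<le> Gdist (f y) (f z)"
      using Gdist_match[OF h(1)[OF yz(1)] f] by blast
    have "b i \<in># msum Q (h z)" using b(1) h(1)[OF yz(2)] i by (metis set_mset_msum image_eqI lessThan_iff)
    then obtain j where j: "j < Q" "b i = h z j" by (auto simp: set_mset_msum)
    have le: "dist (h y i) (h z j) \<le> L * dist y z" using b(2)[OF i] lip[OF yz] j by simp
    have "dist (P i) (P j) \<le> dist (P i) (h y i) + dist (h y i) (h z j) + dist (h z j) (P j)"
      using dist_triangle[of "P i" "P j" "h y i"] dist_triangle[of "h y i" "P j" "h z j"] by linarith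
    also have "\<dots> < s / 4 + s / 4 + s / 4"
      using h(2)[OF yz(1) i] h(2)[OF yz(2) j(1)] le small[OF yz] by (simp add: dist_commute)
    also have "\<dots> \<le> s" using h(2)[OF yz(1) i] zero_le_dist[of "P i" "h y i"] by linarith
    finally have "P i = P j" using sepP i j by blast
    then have "h z i = h z j" using hP yz i j by blast
    then show ?thesis using le by simp
  qed
  show ?thesis
  proof (intro exI[of _ "\<lambda>i y. h y i"] conjI allI impI ballI)
    fix i assume "i < Q" then show "L-lipschitz_on C (\<lambda>y. h y i)"
      using lip_h L by (intro lipschitz_onI) auto
  next
    fix i j x y assume "i < Q" "j < Q" "x \<in> C" "y \<in> C" "h x i = h x j"
    then show "h y i = h y j" using hP by blast
  next
    fix y assume "y \<in> C" then show "f y = msum Q (\<lambda>i. h y i)" by (rule h(1))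
  qed
qed (use L in simp)

text \<open>The gap depends on the point, so \<open>C\<close> is exhausted by the closed sets of gap
  \<open>s n\<close>. These are cut by small balls around a countable dense set, which makes
  matching against one fixed value unambiguous on each piece.\<close>

lemma Lipschitz_selection:
  fixes f :: "'x::{metric_space, second_countable_topology} \<Rightarrow> 'm::metric_space multiset"
  assumes C: "closed C" and f: "\<And>x. f x \<in> AQ Q" and L: "L \<ge> 0"
    and lip: "\<And>x y. x \<in> C \<Longrightarrow> y \<in> C \<Longrightarrow> Gdist (f x) (f y) \<le> L * dist x y"
  shows "\<exists>\<C>. countable \<C> \<and> \<Union>\<C> = C \<and> (\<forall>A\<in>\<C>. closed A \<and>
    (\<exists>g. (\<forall>y\<in>A. f y = msum Q (\<lambda>i. g i y)) \<and> (\<forall>i<Q. L-lipschitz_on A (g i)) \<and>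
       (\<forall>i<Q. \<forall>j<Q. \<forall>x\<in>A. \<forall>y\<in>A. g i x = g j x \<longrightarrow> g i y = g j y)))"
proof -
  define s where "s n = inverse (real (Suc n))" for n
  have s: "s n > 0" for n by (simp add: s_def)
  \<comment> \<open>Two points of a ball of this radius satisfy
    \<open>L * dist x y \<le> s n / 8\<close>, below the \<open>s n / 4\<close> that the selection
    requires; \<open>L + 1\<close> avoids a division by zero.\<close>
  define r where "r n = s n / (16 * (L + 1))" for n
  have r: "r n > 0" for n using s L by (simp add: r_def)
  obtain D :: "'x set" where D: "countable D" "\<And>X. open X \<Longrightarrow> X \<noteq> {} \<Longrightarrow> \<exists>d\<in>D. d \<in> X"
    using countable_dense_exists by blast
  define A where "A n d = {x \<in> C. separated (s n) (f x)} \<inter> cball d (r n)" for n d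
  define \<C> where "\<C> = (\<lambda>(n, d). A n d) ` (UNIV \<times> D)"
  have cov: "\<Union>\<C> = C"
  proof
    show "\<Union>\<C> \<subseteq> C" by (auto simp: \<C>_def A_def)
    show "C \<subseteq> \<Union>\<C>"
    proof
      fix x assume x: "x \<in> C"
      obtain n where n: "separated (s n) (f x)" using ex_separated unfolding s_def by blast
      obtain d where "d \<in> D" "d \<in> ball x (r n)" using D(2)[of "ball x (r n)"] r[of n] by auto
      then have "x \<in> A n d" using x n by (auto simp: A_def dist_commute)
      then show "x \<in> \<Union>\<C>" using \<open>d \<in> D\<close> by (auto simp: \<C>_def)
    qed
  qed
  have small: "L * dist x y < s n / 4" if "x \<in> A n d" "y \<in> A n d" for x y n d
  proof -
    have "dist x y \<le> 2 * r n"
      using that dist_triangle3[of x y d] by (auto simp: A_def)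
    then have "L * dist x y \<le> (L + 1) * (2 * r n)" using L by (intro mult_mono) auto
    also have "\<dots> = s n / 8"
    proof -
      have "L + 1 \<noteq> 0" "16 * L + 16 \<noteq> 0" using L by linarith+
      then show ?thesis by (simp add: r_def field_simps)
    qed
    also have "\<dots> < s n / 4" using s[of n] by simp
    finally show ?thesis .
  qed
  have cl: "closed (A n d)" for n d
    unfolding A_def by (intro closed_Int closed_separated[OF C f L s lip] closed_cball)
  have sel: "\<exists>g. (\<forall>y\<in>A n d. f y = msum Q (\<lambda>i. g i y)) \<and> (\<forall>i<Q. L-lipschitz_on (A n d) (g i)) \<and>
       (\<forall>i<Q. \<forall>j<Q. \<forall>x\<in>A n d. \<forall>y\<in>A n d. g i x = g j x \<longrightarrow> g i y = g j y)" for n d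
    by (rule selection_piece[OF f L _ _ small]) (auto simp: A_def intro: lip)
  have pieces: "closed B \<and>
    (\<exists>g. (\<forall>y\<in>B. f y = msum Q (\<lambda>i. g i y)) \<and> (\<forall>i<Q. L-lipschitz_on B (g i)) \<and>
       (\<forall>i<Q. \<forall>j<Q. \<forall>x\<in>B. \<forall>y\<in>B. g i x = g j x \<longrightarrow> g i y = g j y))" if "B \<in> \<C>" for B
  proof -
    obtain n d where B: "B = A n d" using \<open>B \<in> \<C>\<close> unfolding \<C>_def by auto
    show ?thesis unfolding B using cl sel by (rule conjI)
  qed
  have "countable \<C>" unfolding \<C>_def using D(1) by (intro countable_image) auto
  then show ?thesis by (intro exI[of _ \<C>] conjI[OF _ conjI[OF cov]] ballI pieces)
qed

text \<open>Makes the sum of the branch representatives a legitimate representative of a germ with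
  values in \<open>AQ Q\<close>.\<close>

lemma msum_Lipschitz:
  fixes F :: "nat \<Rightarrow> 'x::metric_space \<Rightarrow> 'm::metric_space"
  assumes "\<And>i. i < Q \<Longrightarrow> lip_into UNIV dist (B i) (F i)" and "\<And>i. i < Q \<Longrightarrow> W \<subseteq> B i"
  obtains \<Lambda> where "\<Lambda> \<ge> 0"
    "\<And>y z. y \<in> W \<Longrightarrow> z \<in> W \<Longrightarrow> Gdist (msum Q (\<lambda>i. F i y)) (msum Q (\<lambda>i. F i z)) \<le> \<Lambda> * dist y z"
proof -
  have "\<forall>i\<in>{..<Q}. \<exists>L. \<forall>y\<in>B i. \<forall>z\<in>B i. dist (F i y) (F i z) \<le> L * dist y z"
    using assms(1) by (auto simp: lip_into_def)
  from bchoice[OF this] obtain L where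
    L: "\<And>i y z. i < Q \<Longrightarrow> y \<in> B i \<Longrightarrow> z \<in> B i \<Longrightarrow> dist (F i y) (F i z) \<le> L i * dist y z" by auto
  show ?thesis
  \<comment> \<open>Absolute values, because \<open>lip_into\<close> puts no sign condition on its
    constant.\<close>
  proof (rule that[of "\<Sum>i<Q. \<bar>L i\<bar>"])
    fix y z assume yz: "y \<in> W" "z \<in> W"
    have "dist (F i y) (F i z) \<le> \<bar>L i\<bar> * dist y z" if "i < Q" for i
    proof -
      have "dist (F i y) (F i z) \<le> L i * dist y z" using L[OF that] assms(2)[OF that] yz by blast
      also have "\<dots> \<le> \<bar>L i\<bar> * dist y z" by (intro mult_right_mono) auto
      finally show ?thesis .
    qed
    then have "(\<Sum>i<Q. dist (F i y) (F i z)) \<le> (\<Sum>i<Q. \<bar>L i\<bar> * dist y z)" by (intro sum_mono) auto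
    also have "\<dots> = (\<Sum>i<Q. \<bar>L i\<bar>) * dist y z" by (simp add: sum_distrib_right)
    finally show "Gdist (msum Q (\<lambda>i. F i y)) (msum Q (\<lambda>i. F i z)) \<le> (\<Sum>i<Q. \<bar>L i\<bar>) * dist y z"
      by (rule order_trans[OF Gdist_le_sum])
  qed (simp add: sum_nonneg)
qed

section \<open>Doubling metric measure spaces\<close>

text \<open>Greedy choice: a ball of largest radius is kept. Every ball meeting it has a radius no
  larger and so lies in its triple; the balls that miss it are left to the induction.\<close>

lemma finite_vitali:
  fixes c :: "'i \<Rightarrow> 'a::metric_space"
  assumes "finite I"
  shows "\<exists>J\<subseteq>I. disjoint_family_on (\<lambda>i. ball (c i) (r i)) J \<and>
           (\<Union>i\<in>I. ball (c i) (r i)) \<subseteq> (\<Union>j\<in>J. ball (c j) (3 * r j))"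
  using assms
proof (induction I rule: finite_psubset_induct)
  case (psubset I)
  show ?case
  proof (cases "I = {}")
    case True then show ?thesis by (auto simp: disjoint_family_on_def)
  next
    case False
    then have ne: "r ` I \<noteq> {}" "finite (r ` I)" using psubset.hyps by auto
    obtain i0 where i0: "i0 \<in> I" "Max (r ` I) = r i0" using Max_in[OF ne(2,1)] by auto
    have mx: "r i \<le> r i0" if "i \<in> I" for i
      using Max_ge[OF ne(2), of "r i"] that i0(2) by auto
    \<comment> \<open>Removing \<open>i0\<close> explicitly matters when all radii are nonpositive:
      its ball is then empty, hence disjoint from itself.\<close>
    define I' where "I' = {i \<in> I. ball (c i) (r i) \<inter> ball (c i0) (r i0) = {}} - {i0}"
    have "I' \<subset> I" using i0(1) by (auto simp: I'_def)
    from psubset.IH[OF this] obtain J where J: "J \<subseteq> I'" "disjoint_family_on (\<lambda>i. ball (c i) (r i)) J"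
      "(\<Union>i\<in>I'. ball (c i) (r i)) \<subseteq> (\<Union>j\<in>J. ball (c j) (3 * r j))" by blast
    have "disjoint_family_on (\<lambda>i. ball (c i) (r i)) (insert i0 J)"
      using J(1,2) by (subst disjoint_family_on_insert) (auto simp: I'_def)
    moreover have cov: "y \<in> (\<Union>j\<in>insert i0 J. ball (c j) (3 * r j))"
      if i: "i \<in> I" and y: "y \<in> ball (c i) (r i)" for i y
    proof (cases "i \<in> I'")
      case True then show ?thesis using J(3) y by blast
    next
      case False
      have "ball (c i) (r i) \<inter> ball (c i0) (r i0) \<noteq> {}"
        using False i y unfolding I'_def by (cases "i = i0") fastforce+
      then obtain z where z: "dist (c i) z < r i" "dist (c i0) z < r i0" by auto
      have "dist (c i0) y < 3 * r i0"
        using dist_triangle[of "c i0" y z] dist_triangle[of z y "c i"] z y mx[OF i]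
        by (simp add: dist_commute)
      then show ?thesis by auto
    qed
    moreover have "(\<Union>i\<in>I. ball (c i) (r i)) \<subseteq> (\<Union>j\<in>insert i0 J. ball (c j) (3 * r j))"
      using cov by blast
    moreover have "insert i0 J \<subseteq> I" using J(1) i0(1) by (auto simp: I'_def)
    ultimately show ?thesis by blast
  qed
qed

locale doubling_space =
  fixes K :: real and \<mu> :: "'x::polish_space set \<Rightarrow> ennreal"
  assumes doubling: "doubling_mms K \<mu>"
begin

text \<open>The Caratheodory restriction of the outer measure. It provides additivity and continuity
  along monotone sequences; estimates for arbitrary sets continue to use \<open>\<mu>\<close>
  itself.\<close>

definition M :: "'x measure" where
  "M = measure_of UNIV (mu_measurable \<mu>) \<mu>"

lemma outer: "outer_measure_space (Pow UNIV) \<mu>"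
  and borel_measurable: "sets borel \<subseteq> mu_measurable \<mu>"
  and borel_hull: "\<exists>B\<in>sets borel. A \<subseteq> B \<and> \<mu> B = \<mu> A"
  and K_pos: "K > 0"
  using doubling by (auto simp: doubling_mms_def borel_regular_outer_measure_def mu_measurable_def)

lemma ball_pos: "r > 0 \<Longrightarrow> 0 < \<mu> (ball x r)"
  and ball_finite: "\<mu> (ball x r) < \<infinity>"
  and ball_double: "\<mu> (ball x (2 * r)) \<le> ennreal K * \<mu> (ball x r)"
proof -
  have D: "0 < \<mu> (ball x (2 * r))" "\<mu> (ball x (2 * r)) \<le> ennreal K * \<mu> (ball x r)" "\<mu> (ball x r) < \<infinity>" if "r > 0" for r x
    using doubling that by (auto simp: doubling_mms_def)
  have E: "\<mu> {} = 0"
    using outer by (auto simp: outer_measure_space_def positive_def)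
  show "r > 0 \<Longrightarrow> 0 < \<mu> (ball x r)" using D(1)[of "r/2" x] by simp
  show "\<mu> (ball x r) < \<infinity>" using D(3)[of r x] E by (cases "r > 0") (auto simp: ball_empty)
  show "\<mu> (ball x (2 * r)) \<le> ennreal K * \<mu> (ball x r)" using D(2)[of r x] E by (cases "r > 0") (auto simp: ball_empty)
qed

lemma ball_double2: "\<mu> (ball x (4 * r)) \<le> ennreal (K\<^sup>2) * \<mu> (ball x r)"
proof -
  have "\<mu> (ball x (4 * r)) \<le> ennreal K * \<mu> (ball x (2 * r))"
    using ball_double[of x "2 * r"] by simp
  also have "\<dots> \<le> ennreal K * (ennreal K * \<mu> (ball x r))"
    by (intro mult_left_mono ball_double) auto
  finally show ?thesis
    using K_pos by (simp add: power2_eq_square ennreal_mult' mult.assoc)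
qed

lemma mu_mono: "A \<subseteq> B \<Longrightarrow> \<mu> A \<le> \<mu> B"
  using outer by (auto simp: outer_measure_space_def increasing_def)

lemma mu_empty [simp]: "\<mu> {} = 0"
  using outer by (auto simp: outer_measure_space_def positive_def)

lemma mu_Un_le: "\<mu> (A \<union> B) \<le> \<mu> A + \<mu> B"
proof -
  interpret sigma_algebra "UNIV :: 'x set" "Pow UNIV" by (rule sigma_algebra_Pow)
  have "subadditive (Pow UNIV) \<mu>"
    using outer by (intro countably_subadditive_subadditive) (auto simp: outer_measure_space_def)
  then have 1: "\<mu> (A \<union> (B - A)) \<le> \<mu> A + \<mu> (B - A)"
    by (rule subadditiveD) auto
  have "\<mu> (B - A) \<le> \<mu> B" by (rule mu_mono) auto
  with 1 show ?thesis by (simp add: add_left_mono order_trans)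
qed

lemma measure_space_M: "measure_space UNIV (mu_measurable \<mu>) \<mu>"
  unfolding mu_measurable_def
  by (rule sigma_algebra.caratheodory_lemma[OF sigma_algebra_Pow outer])

lemma space_M [simp]: "space M = UNIV"
  and sets_M [simp]: "sets M = mu_measurable \<mu>"
proof -
  interpret sigma_algebra UNIV "mu_measurable \<mu>"
    using measure_space_M by (auto simp: measure_space_def)
  show "space M = UNIV" "sets M = mu_measurable \<mu>" by (simp_all add: M_def)
qed

lemma emeasure_M: "A \<in> mu_measurable \<mu> \<Longrightarrow> emeasure M A = \<mu> A"
  using measure_space_M unfolding M_def
  by (subst emeasure_measure_of_sigma) (auto simp: measure_space_def)

lemma measurableI_null: assumes "\<mu> A = 0" shows "A \<in> mu_measurable \<mu>"
proof -
  have "\<mu> (z \<inter> A) + \<mu> (z - A) = \<mu> z" for z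
  proof (rule antisym)
    have "\<mu> (z \<inter> A) \<le> \<mu> A" by (rule mu_mono) auto
    moreover have "\<mu> (z - A) \<le> \<mu> z" by (rule mu_mono) auto
    ultimately show "\<mu> (z \<inter> A) + \<mu> (z - A) \<le> \<mu> z" using assms by auto
    show "\<mu> z \<le> \<mu> (z \<inter> A) + \<mu> (z - A)"
      using mu_Un_le[of "z \<inter> A" "z - A"] by (simp add: Int_Diff_Un)
  qed
  then show ?thesis
    unfolding mu_measurable_def lambda_system_def by (auto simp: Int_commute Diff_eq)
qed

lemma null_sets_M: "A \<in> null_sets M \<longleftrightarrow> \<mu> A = 0"
  using measurableI_null emeasure_M by (auto simp: null_sets_def)

lemma null_UN: "countable I \<Longrightarrow> (\<And>i. i \<in> I \<Longrightarrow> \<mu> (A i) = 0) \<Longrightarrow> \<mu> (\<Union>i\<in>I. A i) = 0"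
  using null_sets_UN'[of I A M] by (simp add: null_sets_M)

lemma null_subset: "A \<subseteq> B \<Longrightarrow> \<mu> B = 0 \<Longrightarrow> \<mu> A = 0"
  using mu_mono[of A B] by simp

lemma null_Un: "\<mu> A = 0 \<Longrightarrow> \<mu> B = 0 \<Longrightarrow> \<mu> (A \<union> B) = 0"
  using mu_Un_le[of A B] by simp

lemma borel_in_M: "A \<in> sets borel \<Longrightarrow> A \<in> sets M"
  using borel_measurable by auto

lemma emeasure_M_borel: "A \<in> sets borel \<Longrightarrow> emeasure M A = \<mu> A"
  using borel_measurable emeasure_M by auto

section \<open>Sets of density zero and \<open>\<mu>\<close>-neighbourhoods\<close>

definition thin_at :: "'x \<Rightarrow> 'x set \<Rightarrow> bool" where
  "thin_at x N \<longleftrightarrow> (\<forall>\<epsilon>>0. \<exists>\<delta>>0. \<forall>r. 0 < r \<longrightarrow> r < \<delta> \<longrightarrow> \<mu> (ball x r \<inter> N) \<le> ennreal \<epsilon> * \<mu> (ball x r))"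

text \<open>Balls have positive finite measure, so the real quotient in \<open>mu_nbhd\<close> can
  be multiplied out. The resulting condition \<open>thin_at\<close> lives in \<open>ennreal\<close>
  and makes sense for non-measurable sets as well.\<close>

lemma mu_nbhd_iff:
  "mu_nbhd \<mu> x E \<longleftrightarrow> x \<in> E \<and> (\<exists>B\<in>sets borel. B \<subseteq> E \<and> thin_at x (- B))"
proof -
  let ?q = "\<lambda>B r. enn2real (\<mu> (ball x r - B)) / enn2real (\<mu> (ball x r))"
  have fin: "\<mu> (ball x r - B) < \<infinity>" for r B
    using ball_finite[of x r] mu_mono[of "ball x r - B" "ball x r"] by auto
  have q: "?q B r \<le> \<epsilon> \<longleftrightarrow> \<mu> (ball x r \<inter> - B) \<le> ennreal \<epsilon> * \<mu> (ball x r)" if re: "r > 0" "\<epsilon> > 0" for B r \<epsilon>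
  proof -
    obtain m where m: "\<mu> (ball x r) = ennreal m" "m > 0"
      using ball_pos[of r x] ball_finite[of x r] re by (cases "\<mu> (ball x r)") auto
    obtain n where n: "\<mu> (ball x r - B) = ennreal n" "n \<ge> 0"
      using fin[of r B] by (cases "\<mu> (ball x r - B)") auto
    show ?thesis
      unfolding Diff_eq[symmetric] m(1) n(1) using m(2) n(2) re
      by (simp add: divide_le_eq ennreal_mult[symmetric] ennreal_le_iff)
  qed
  have "(?q B \<longlongrightarrow> 0) (at_right 0) \<longleftrightarrow> thin_at x (- B)" for B
  proof
    assume L: "(?q B \<longlongrightarrow> 0) (at_right 0)"
    show "thin_at x (- B)"
      unfolding thin_at_def
    proof (intro allI impI)
      fix \<epsilon> :: real assume e: "\<epsilon> > 0"
      from tendstoD[OF L e] obtain \<delta> where "\<delta> > 0" "\<And>r. r > 0 \<Longrightarrow> r < \<delta> \<Longrightarrow> dist (?q B r) 0 < \<epsilon>"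
        unfolding eventually_at_right_field by auto
      then have "?q B r \<le> \<epsilon>" if "0 < r" "r < \<delta>" for r using that by fastforce
      then show "\<exists>\<delta>>0. \<forall>r. 0 < r \<longrightarrow> r < \<delta> \<longrightarrow> \<mu> (ball x r \<inter> - B) \<le> ennreal \<epsilon> * \<mu> (ball x r)"
        using q[OF _ e] \<open>\<delta> > 0\<close> by blast
    qed
  next
    assume R: "thin_at x (- B)"
    show "(?q B \<longlongrightarrow> 0) (at_right 0)"
    proof (rule tendstoI)
      fix \<epsilon> :: real assume e: "\<epsilon> > 0"
      then have e2: "\<epsilon> / 2 > 0" by simp
      obtain \<delta> where \<delta>: "\<delta> > 0"
        "\<And>r. 0 < r \<Longrightarrow> r < \<delta> \<Longrightarrow> \<mu> (ball x r \<inter> - B) \<le> ennreal (\<epsilon>/2) * \<mu> (ball x r)"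
        using R e2 unfolding thin_at_def by blast
      have "\<bar>?q B r\<bar> < \<epsilon>" if "0 < r" "r < \<delta>" for r
      proof -
        have "?q B r \<le> \<epsilon> / 2" using \<delta>(2)[OF that] q[OF that(1) e2] by blast
        moreover have "?q B r \<ge> 0" by simp
        ultimately show ?thesis using e by linarith
      qed
      then show "\<forall>\<^sub>F r in at_right 0. dist (?q B r) 0 < \<epsilon>"
        unfolding eventually_at_right_field using \<delta>(1) by (intro exI[of _ \<delta>]) auto
    qed
  qed
  then show ?thesis unfolding mu_nbhd_def by blast
qed

lemma thin_at_subset: "thin_at x N \<Longrightarrow> N' \<subseteq> N \<Longrightarrow> thin_at x N'"
  unfolding thin_at_def by (meson Int_mono mu_mono order_refl order_trans)

lemma thin_at_Un: assumes "thin_at x N" "thin_at x N'" shows "thin_at x (N \<union> N')"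
  unfolding thin_at_def
proof (intro allI impI)
  fix \<epsilon> :: real assume e: "\<epsilon> > 0"
  then have e2: "\<epsilon> / 2 > 0" by simp
  obtain \<delta> where d: "\<delta> > 0" "\<And>r. 0 < r \<Longrightarrow> r < \<delta> \<Longrightarrow> \<mu> (ball x r \<inter> N) \<le> ennreal (\<epsilon>/2) * \<mu> (ball x r)"
    using assms(1) e2 unfolding thin_at_def by blast
  obtain \<delta>' where d': "\<delta>' > 0" "\<And>r. 0 < r \<Longrightarrow> r < \<delta>' \<Longrightarrow> \<mu> (ball x r \<inter> N') \<le> ennreal (\<epsilon>/2) * \<mu> (ball x r)"
    using assms(2) e2 unfolding thin_at_def by blast
  have "\<mu> (ball x r \<inter> (N \<union> N')) \<le> ennreal \<epsilon> * \<mu> (ball x r)" if "0 < r" "r < min \<delta> \<delta>'" for r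
  proof -
    have "\<mu> (ball x r \<inter> (N \<union> N')) \<le> \<mu> (ball x r \<inter> N) + \<mu> (ball x r \<inter> N')"
      using mu_Un_le[of "ball x r \<inter> N" "ball x r \<inter> N'"] by (simp add: Int_Un_distrib)
    also have "\<dots> \<le> ennreal (\<epsilon>/2) * \<mu> (ball x r) + ennreal (\<epsilon>/2) * \<mu> (ball x r)"
      using that d d' by (intro add_mono) auto
    also have "\<dots> = ennreal \<epsilon> * \<mu> (ball x r)"
      using e by (simp add: distrib_right[symmetric] ennreal_plus[symmetric] del: ennreal_plus)
    finally show ?thesis .
  qed
  then show "\<exists>\<delta>>0. \<forall>r. 0 < r \<longrightarrow> r < \<delta> \<longrightarrow> \<mu> (ball x r \<inter> (N \<union> N')) \<le> ennreal \<epsilon> * \<mu> (ball x r)"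
    using d(1) d'(1) by (intro exI[of _ "min \<delta> \<delta>'"]) auto
qed

lemma thin_at_ball_compl: assumes "s > 0" shows "thin_at x (- ball x s)"
proof -
  have "ball x r \<inter> - ball x s = {}" if "r < s" for r using that by auto
  then show ?thesis using assms unfolding thin_at_def by auto
qed

lemma mu_nbhd_thin: "mu_nbhd \<mu> x U \<Longrightarrow> thin_at x (- U)"
  unfolding mu_nbhd_iff by (metis Compl_subset_Compl_iff thin_at_subset)

lemma mu_nbhdI: "U \<in> sets borel \<Longrightarrow> x \<in> U \<Longrightarrow> thin_at x (- U) \<Longrightarrow> mu_nbhd \<mu> x U"
  unfolding mu_nbhd_iff by blast

lemma mu_nbhd_ball: "s > 0 \<Longrightarrow> mu_nbhd \<mu> x (ball x s)"
  by (intro mu_nbhdI thin_at_ball_compl) auto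

lemma mu_nbhd_mono: "mu_nbhd \<mu> x U \<Longrightarrow> U \<subseteq> V \<Longrightarrow> mu_nbhd \<mu> x V"
  unfolding mu_nbhd_iff by blast

lemma mu_nbhd_UNIV: "mu_nbhd \<mu> x UNIV"
  using mu_nbhd_mono[OF mu_nbhd_ball[of 1 x]] by simp

lemma mu_nbhd_Int: assumes "mu_nbhd \<mu> x U" "mu_nbhd \<mu> x V" shows "mu_nbhd \<mu> x (U \<inter> V)"
proof -
  obtain B C where B: "B \<in> sets borel" "B \<subseteq> U" "thin_at x (- B)"
    and C: "C \<in> sets borel" "C \<subseteq> V" "thin_at x (- C)" and x: "x \<in> U" "x \<in> V"
    using assms unfolding mu_nbhd_iff by blast
  have "thin_at x (- (B \<inter> C))" using thin_at_Un[OF B(3) C(3)] by simp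
  then show ?thesis unfolding mu_nbhd_iff using B C x by (intro conjI bexI[of _ "B \<inter> C"]) auto
qed

lemma mu_nbhd_INT: "finite I \<Longrightarrow> (\<And>i. i \<in> I \<Longrightarrow> mu_nbhd \<mu> x (U i)) \<Longrightarrow> mu_nbhd \<mu> x (\<Inter>i\<in>I. U i)"
  by (induction I rule: finite_induct) (auto simp: mu_nbhd_UNIV mu_nbhd_Int)

lemma mu_nbhd_borel: assumes "mu_nbhd \<mu> x U"
  obtains W where "W \<in> sets borel" "W \<subseteq> U" "mu_nbhd \<mu> x W"
proof -
  obtain B where B: "B \<in> sets borel" "B \<subseteq> U" "thin_at x (- B)" "x \<in> U"
    using assms unfolding mu_nbhd_iff by blast
  show ?thesis
  \<comment> \<open>The Borel set inside a \<open>\<mu>\<close>-neighbourhood need not contain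
    \<open>x\<close>.\<close>
  proof (rule that[of "insert x B"])
    show "mu_nbhd \<mu> x (insert x B)"
      using B by (intro mu_nbhdI) (auto intro: thin_at_subset[OF B(3)])
  qed (use B in auto)
qed

text \<open>By doubling, \<open>ball y (c * dist y x)\<close> carries a fixed fraction of the measure of
  \<open>ball x (2 * dist y x)\<close>, so a set thin at \<open>x\<close> cannot contain it.\<close>
lemma thin_at_near:
  assumes thin: "thin_at x (- U)" and c: "0 < c" "c \<le> 1"
  obtains \<delta> where "\<delta> > 0" "\<And>y. y \<noteq> x \<Longrightarrow> dist y x < \<delta> \<Longrightarrow> \<exists>z\<in>U. dist z y < c * dist y x"
proof -
  have pw: "\<mu> (ball y (2 ^ n * r)) \<le> ennreal (K ^ n) * \<mu> (ball y r)" for y n r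
  proof (induction n)
    case (Suc n)
    have "\<mu> (ball y (2 ^ Suc n * r)) \<le> ennreal K * \<mu> (ball y (2 ^ n * r))"
      using ball_double[of y "2 ^ n * r"] by (simp add: mult.assoc)
    also have "\<dots> \<le> ennreal K * (ennreal (K ^ n) * \<mu> (ball y r))"
      by (intro mult_left_mono Suc.IH) auto
    finally show ?case using K_pos by (simp add: ennreal_mult' mult.assoc)
  qed simp
  \<comment> \<open>With \<open>d = dist y x\<close>, the ball of radius \<open>2 * d\<close> about
    \<open>x\<close> lies in the ball of radius \<open>3 * d\<close> about \<open>y\<close>;
    \<open>n\<close> doublings of the radius \<open>c * d\<close> exceed
    \<open>3 * d\<close>.\<close>
  obtain n where n: "3 / c < 2 ^ n" using real_arch_pow[of 2 "3 / c"] by auto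
  have Kn: "K ^ n > 0" using K_pos by simp
  \<comment> \<open>The factor \<open>K ^ n\<close> cancels the loss from \<open>n\<close> doublings
    and the \<open>2\<close> leaves \<open>m \<le> m / 2\<close>, a contradiction for the positive
    measure \<open>m\<close>.\<close>
  then have "inverse (2 * K ^ n) > 0" by simp
  then obtain \<delta> where \<delta>: "\<delta> > 0"
    "\<And>r. 0 < r \<Longrightarrow> r < \<delta> \<Longrightarrow> \<mu> (ball x r \<inter> - U) \<le> ennreal (inverse (2 * K ^ n)) * \<mu> (ball x r)"
    using thin unfolding thin_at_def by blast
  show ?thesis
  proof (rule that[of "\<delta> / 2"])
    show "\<delta> / 2 > 0" using \<delta>(1) by simp
    fix y assume y: "y \<noteq> x" "dist y x < \<delta> / 2"
    define d where "d = dist y x"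
    have d: "d > 0" "2 * d < \<delta>" using y by (auto simp: d_def)
    show "\<exists>z\<in>U. dist z y < c * dist y x"
    proof (rule ccontr)
      assume neg: "\<not> ?thesis"
      have cd: "c * d \<le> d" using c d by simp
      have "ball y (c * d) \<subseteq> ball x (2 * d) \<inter> - U"
      proof
        fix z assume z: "z \<in> ball y (c * d)"
        then have "z \<notin> U" using neg by (auto simp: d_def dist_commute)
        moreover have "dist x z < 2 * d"
          using z dist_triangle[of x z y] cd by (auto simp: d_def dist_commute)
        ultimately show "z \<in> ball x (2 * d) \<inter> - U" by simp
      qed
      then have "\<mu> (ball y (c * d)) \<le> \<mu> (ball x (2 * d) \<inter> - U)" by (rule mu_mono)
      also have "\<dots> \<le> ennreal (inverse (2 * K ^ n)) * \<mu> (ball x (2 * d))"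
        using d by (intro \<delta>(2)) auto
      also have "\<mu> (ball x (2 * d)) \<le> \<mu> (ball y (2 ^ n * (c * d)))"
      proof (rule mu_mono, rule)
        fix z assume z: "z \<in> ball x (2 * d)"
        have "dist y z < 3 * d" using z dist_triangle[of y z x] by (auto simp: d_def)
        also have "3 * d \<le> 2 ^ n * (c * d)"
          using n c d by (simp add: divide_less_eq mult.assoc[symmetric])
        finally show "z \<in> ball y (2 ^ n * (c * d))" by simp
      qed
      also have "\<dots> \<le> ennreal (K ^ n) * \<mu> (ball y (c * d))" by (rule pw)
      finally have le: "\<mu> (ball y (c * d)) \<le> ennreal (inverse (2 * K ^ n)) * (ennreal (K ^ n) * \<mu> (ball y (c * d)))"
        by (simp add: mult_left_mono)
      obtain m where m: "\<mu> (ball y (c * d)) = ennreal m" "m > 0"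
        using ball_pos[of "c * d" y] ball_finite[of y "c * d"] c d by (cases "\<mu> (ball y (c * d))") auto
      have "m \<le> inverse (2 * K ^ n) * (K ^ n * m)"
        using le m(2) Kn by (simp add: m(1) ennreal_mult[symmetric] del: inverse_mult_distrib)
      also have "\<dots> = m / 2" using K_pos by (simp add: field_simps)
      finally show False using m(2) by simp
    qed
  qed
qed

text \<open>With factor \<open>1\<close>, the point of \<open>U\<close> found near \<open>y\<close>
  is closer to \<open>y\<close> than \<open>x\<close> is, hence different from \<open>x\<close>. At
  an isolated point this fails, since \<open>{x}\<close> is then itself a
  \<open>\<mu>\<close>-neighbourhood.\<close>

lemma thin_at_meets:
  assumes "thin_at x (- U)" "x islimpt UNIV"
  shows "U - {x} \<noteq> {}"
proof -
  obtain \<delta> where \<delta>: "\<delta> > 0" "\<And>y. y \<noteq> x \<Longrightarrow> dist y x < \<delta> \<Longrightarrow> \<exists>z\<in>U. dist z y < 1 * dist y x"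
    using thin_at_near[OF assms(1), of 1] by (metis order_refl zero_less_one)
  obtain y where "y \<noteq> x" "dist y x < \<delta>"
    using assms(2) \<delta>(1) unfolding islimpt_approachable by blast
  then obtain z where "z \<in> U" "dist z y < dist y x" using \<delta>(2) by auto
  then show ?thesis by (auto simp: dist_commute)
qed

lemma mu_accumI: assumes "mu_nbhd \<mu> x A" "x islimpt UNIV" shows "mu_accum \<mu> A x"
  unfolding mu_accum_def
  using thin_at_meets[OF mu_nbhd_thin assms(2)] mu_nbhd_Int[OF assms(1)] by blast

lemma mu_accum_islimpt: assumes "mu_accum \<mu> A x" shows "x islimpt A"
  unfolding islimpt_approachable
proof (intro allI impI)
  fix e :: real assume "e > 0"
  then have "A \<inter> ball x e - {x} \<noteq> {}" using assms mu_nbhd_ball unfolding mu_accum_def by blast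
  then show "\<exists>x'\<in>A. x' \<noteq> x \<and> dist x' x < e" by (auto simp: dist_commute)
qed

text \<open>Lindelof reduces the balls to a sequence, and the covering lemma is applied to its first
  \<open>k\<close> members. The selected balls are disjoint, and each has at least the fraction
  \<open>t\<close> of its measure outside \<open>C\<close>, so their total measure is at most that
  of \<open>U - C\<close> divided by \<open>t\<close>. Letting \<open>k\<close> grow covers
  \<open>N\<close>, which need not be measurable.\<close>

lemma vitali_bound:
  assumes C: "C \<in> sets borel" and U: "open U" and t: "t > 0"
    and N: "\<And>x. x \<in> N \<Longrightarrow> \<exists>r>0. ball x r \<subseteq> U \<and> ennreal t * \<mu> (ball x r) \<le> \<mu> (ball x r - C)"
  shows "\<mu> N \<le> ennreal (K\<^sup>2 / t) * \<mu> (U - C)"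
proof (cases "N = {}")
  case False
  obtain r where r: "\<And>x. x \<in> N \<Longrightarrow> r x > 0" "\<And>x. x \<in> N \<Longrightarrow> ball x (r x) \<subseteq> U"
    "\<And>x. x \<in> N \<Longrightarrow> ennreal t * \<mu> (ball x (r x)) \<le> \<mu> (ball x (r x) - C)"
    using N by metis
  obtain F where F: "F \<subseteq> (\<lambda>x. ball x (r x)) ` N" "countable F" "\<Union>F = \<Union>((\<lambda>x. ball x (r x)) ` N)"
    using Lindelof[of "(\<lambda>x. ball x (r x)) ` N"] by auto
  obtain X where X: "X \<subseteq> N" "countable X" "F = (\<lambda>x. ball x (r x)) ` X"
    using countable_subset_image[of F "\<lambda>x. ball x (r x)" N] F(1,2) by auto
  have NX: "N \<subseteq> (\<Union>x\<in>X. ball x (r x))"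
    using F(3) X(3) r(1) by (metis UN_I centre_in_ball subsetI)
  then have "X \<noteq> {}" using False by auto
  define c where "c = from_nat_into X"
  have c: "c i \<in> X" "c i \<in> N" for i using from_nat_into[OF \<open>X \<noteq> {}\<close>, of i] X(1) by (auto simp: c_def)
  have rc: "range c = X" unfolding c_def using \<open>X \<noteq> {}\<close> X(2) by (rule range_from_nat_into)
  define V where "V k = (\<Union>i<k. ball (c i) (r (c i)))" for k
  have Vb: "V k \<in> sets borel" for k by (auto simp: V_def)
  have bound: "\<mu> (V k) \<le> ennreal (K\<^sup>2 / t) * \<mu> (U - C)" for k
  proof -
    obtain J where J: "J \<subseteq> {..<k}" "disjoint_family_on (\<lambda>i. ball (c i) (r (c i))) J"
      "V k \<subseteq> (\<Union>j\<in>J. ball (c j) (3 * r (c j)))"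
      using finite_vitali[of "{..<k}" c "\<lambda>i. r (c i)"] unfolding V_def by auto
    have fJ: "finite J" using J(1) finite_subset by blast
    \<comment> \<open>The factor \<open>3\<close> of the covering lemma is rounded up to
      \<open>4\<close>, which costs two doublings and explains \<open>K\<^sup>2\<close>.\<close>
    have sub: "V k \<subseteq> (\<Union>j\<in>J. ball (c j) (4 * r (c j)))"
    proof
      fix y assume "y \<in> V k"
      then obtain j where "j \<in> J" "dist (c j) y < 3 * r (c j)" using J(3) by auto
      moreover have "r (c j) > 0" using r(1) c by auto
      ultimately show "y \<in> (\<Union>j\<in>J. ball (c j) (4 * r (c j)))" by (intro UN_I[of j]) auto
    qed
    have one: "\<mu> (ball (c j) (4 * r (c j))) \<le> ennreal (K\<^sup>2 / t) * \<mu> (ball (c j) (r (c j)) - C)" for j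
    proof -
      have "\<mu> (ball (c j) (4 * r (c j))) \<le> ennreal (K\<^sup>2) * \<mu> (ball (c j) (r (c j)))" by (rule ball_double2)
      also have "\<dots> = ennreal (K\<^sup>2 / t) * (ennreal t * \<mu> (ball (c j) (r (c j))))"
        using t by (simp add: mult.assoc[symmetric] ennreal_mult[symmetric])
      also have "\<dots> \<le> ennreal (K\<^sup>2 / t) * \<mu> (ball (c j) (r (c j)) - C)"
        using r(3)[OF c(2)] by (intro mult_left_mono) auto
      finally show ?thesis .
    qed
    have "\<mu> (V k) \<le> \<mu> (\<Union>j\<in>J. ball (c j) (4 * r (c j)))" using sub by (rule mu_mono)
    also have "\<dots> = emeasure M (\<Union>j\<in>J. ball (c j) (4 * r (c j)))"
      by (subst emeasure_M_borel) auto
    also have "\<dots> \<le> (\<Sum>j\<in>J. emeasure M (ball (c j) (4 * r (c j))))"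
      using fJ borel_in_M by (intro emeasure_subadditive_finite) auto
    also have "\<dots> = (\<Sum>j\<in>J. \<mu> (ball (c j) (4 * r (c j))))" by (simp add: emeasure_M_borel)
    also have "\<dots> \<le> (\<Sum>j\<in>J. ennreal (K\<^sup>2 / t) * \<mu> (ball (c j) (r (c j)) - C))"
      by (intro sum_mono one)
    also have "\<dots> = ennreal (K\<^sup>2 / t) * (\<Sum>j\<in>J. emeasure M (ball (c j) (r (c j)) - C))"
      using C by (simp add: sum_distrib_left emeasure_M_borel)
    also have "(\<Sum>j\<in>J. emeasure M (ball (c j) (r (c j)) - C)) = emeasure M (\<Union>j\<in>J. ball (c j) (r (c j)) - C)"
    proof (rule sum_emeasure)
      show "disjoint_family_on (\<lambda>j. ball (c j) (r (c j)) - C) J"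
        using J(2) unfolding disjoint_family_on_def by blast
      show "(\<lambda>j. ball (c j) (r (c j)) - C) ` J \<subseteq> sets M"
        using C borel_in_M by (intro image_subsetI borel_in_M) auto
    qed fact
    also have "\<dots> = \<mu> (\<Union>j\<in>J. ball (c j) (r (c j)) - C)"
      using C fJ by (intro emeasure_M_borel) auto
    also have "\<dots> \<le> \<mu> (U - C)" using r(2) c by (intro mu_mono) blast
    finally show ?thesis by (simp add: mult_left_mono)
  qed
  have "\<mu> N \<le> \<mu> (\<Union>k. V k)"
  proof (rule mu_mono, rule)
    fix y assume "y \<in> N"
    then obtain i where "y \<in> ball (c i) (r (c i))" using NX rc by fastforce
    then show "y \<in> (\<Union>k. V k)" unfolding V_def by blast
  qed
  also have "\<dots> = emeasure M (\<Union>k. V k)" using Vb by (subst emeasure_M_borel) auto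
  also have "\<dots> = (SUP k. emeasure M (V k))"
    using Vb borel_in_M
    by (intro SUP_emeasure_incseq[symmetric]) (auto simp: V_def incseq_def intro: less_le_trans)
  also have "\<dots> \<le> ennreal (K\<^sup>2 / t) * \<mu> (U - C)"
    using bound Vb by (auto intro!: SUP_least simp: emeasure_M_borel)
  finally show ?thesis .
qed simp

text \<open>The points of a bounded part of \<open>C\<close> where the complement keeps a fixed
  fraction of arbitrarily small balls lie in every open set \<open>O' k\<close> around that part.
  The Vitali bound controls them by the measure of \<open>O' k - C\<close>, which tends to zero
  because \<open>C\<close> is closed. Countably many fractions and bounds exhaust the exceptional
  set.\<close>

theorem lebesgue_density:
  assumes C: "closed C"
  shows "\<mu> {x \<in> C. \<not> thin_at x (- C)} = 0"
proof (cases "C = {}")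
  case False
  have Cb: "C \<in> sets borel" using C by auto
  define x0 :: 'x where "x0 = (SOME x. True)"
  define N where "N m n = {x \<in> C \<inter> ball x0 (real m). \<forall>\<delta>>0. \<exists>r. 0 < r \<and> r < \<delta> \<and>
      ennreal (inverse (Suc n)) * \<mu> (ball x r) \<le> \<mu> (ball x r - C)}" for m n :: nat
  have null: "\<mu> (N m n) = 0" for m n
  proof -
    define t where "t = inverse (real (Suc n))"
    have t: "t > 0" by (simp add: t_def)
    \<comment> \<open>Intersecting with a ball keeps the measures finite, as continuity from above
      demands.\<close>
    define O' where "O' k = {y. infdist y C < inverse (real (Suc k))} \<inter> ball x0 (real m)" for k
    have O1: "open (O' k)" for k
      unfolding O'_def by (intro open_Int open_ball open_Collect_less continuous_intros)
    have "\<mu> (N m n) \<le> ennreal (K\<^sup>2 / t) * \<mu> (O' k - C)" for k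
    proof (rule vitali_bound[OF Cb O1 t])
      fix x assume x: "x \<in> N m n"
      then have "x \<in> O' k" by (auto simp: N_def O'_def)
      then obtain e where "e > 0" "ball x e \<subseteq> O' k" using O1 openE by blast
      moreover obtain r where "0 < r" "r < e" "ennreal t * \<mu> (ball x r) \<le> \<mu> (ball x r - C)"
        using x \<open>e > 0\<close> unfolding N_def t_def by blast
      moreover have "ball x r \<subseteq> ball x e" using \<open>r < e\<close> by auto
      ultimately show "\<exists>r>0. ball x r \<subseteq> O' k \<and> ennreal t * \<mu> (ball x r) \<le> \<mu> (ball x r - C)" by blast
    qed
    moreover have "(\<lambda>k. ennreal (K\<^sup>2 / t) * \<mu> (O' k - C)) \<longlonglongrightarrow> ennreal (K\<^sup>2 / t) * 0"
    proof (rule ennreal_tendsto_cmult)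
      have b: "O' k - C \<in> sets borel" for k using O1 Cb by auto
      have "(\<lambda>k. emeasure M (O' k - C)) \<longlonglongrightarrow> emeasure M (\<Inter>k. O' k - C)"
      proof (rule Lim_emeasure_decseq)
        show "range (\<lambda>k. O' k - C) \<subseteq> sets M" using b borel_in_M by blast
        show "decseq (\<lambda>k. O' k - C)"
        proof (rule decseq_SucI)
          fix k show "O' (Suc k) - C \<subseteq> O' k - C"
            unfolding O'_def by (auto elim!: less_le_trans intro: le_imp_inverse_le)
        qed
        show "emeasure M (O' k - C) \<noteq> \<infinity>" for k
        proof -
          have "\<mu> (O' k - C) \<le> \<mu> (ball x0 (real m))" by (rule mu_mono) (auto simp: O'_def)
          then have "\<mu> (O' k - C) < \<infinity>" using ball_finite order.strict_trans1 by blast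
          then show ?thesis by (simp add: emeasure_M_borel[OF b])
        qed
      qed
      moreover have "(\<Inter>k. O' k - C) = {}"
      proof -
        have False if "\<And>k. y \<in> O' k" "y \<notin> C" for y
        proof -
          have "infdist y C > 0" using infdist_pos_not_in_closed[OF C False that(2)] .
          then obtain k where "inverse (real (Suc k)) < infdist y C" using reals_Archimedean by blast
          then show False using that(1)[of k] by (auto simp: O'_def)
        qed
        then show ?thesis by blast
      qed
      ultimately show "(\<lambda>k. \<mu> (O' k - C)) \<longlonglongrightarrow> 0"
        by (simp only: emeasure_M_borel[OF b] emeasure_empty)
    qed auto
    ultimately have "\<mu> (N m n) \<le> ennreal (K\<^sup>2 / t) * 0"
      by (intro LIMSEQ_le_const[where a = "\<mu> (N m n)"]) auto
    then show ?thesis by simp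
  qed
  have "{x \<in> C. \<not> thin_at x (- C)} \<subseteq> (\<Union>m. \<Union>n. N m n)"
  proof
    fix x assume x: "x \<in> {x \<in> C. \<not> thin_at x (- C)}"
    then obtain \<epsilon> where e: "\<epsilon> > 0"
      "\<And>\<delta>. \<delta> > 0 \<Longrightarrow> \<exists>r. 0 < r \<and> r < \<delta> \<and> \<not> \<mu> (ball x r \<inter> - C) \<le> ennreal \<epsilon> * \<mu> (ball x r)"
      unfolding thin_at_def by blast
    obtain n where n: "inverse (real (Suc n)) < \<epsilon>" using reals_Archimedean[OF e(1)] by blast
    obtain m where m: "dist x0 x < real m" using reals_Archimedean2 by blast
    have "\<exists>r. 0 < r \<and> r < \<delta> \<and> ennreal (inverse (Suc n)) * \<mu> (ball x r) \<le> \<mu> (ball x r - C)" if pos: "\<delta> > 0" for \<delta>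
    proof -
      obtain r where r: "0 < r" "r < \<delta>" "\<not> \<mu> (ball x r \<inter> - C) \<le> ennreal \<epsilon> * \<mu> (ball x r)"
        using e(2)[OF pos] by blast
      have "ennreal (inverse (Suc n)) * \<mu> (ball x r) \<le> ennreal \<epsilon> * \<mu> (ball x r)"
        using n by (intro mult_right_mono ennreal_leI) auto
      also have "\<dots> \<le> \<mu> (ball x r - C)" using r(3) by (simp add: Diff_eq)
      finally show ?thesis using r(1,2) by blast
    qed
    then have "x \<in> N m n" using x m unfolding N_def by auto
    then show "x \<in> (\<Union>m. \<Union>n. N m n)" by blast
  qed
  moreover have "\<mu> (\<Union>m. \<Union>n. N m n) = 0" by (intro null_UN null) auto
  ultimately show ?thesis by (rule null_subset)
qed simp

section \<open>Exhausting measurable sets by closed sets up to null sets\<close>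

lemma borel_sigma_closed:
  assumes B: "B \<in> sets borel" "B \<subseteq> ball x0 R"
  shows "\<exists>C :: nat \<Rightarrow> 'x set. (\<forall>n. closed (C n) \<and> C n \<subseteq> B) \<and> \<mu> (B - (\<Union>n. C n)) = 0"
proof -
  \<comment> \<open>Inner regularity by compact sets is used for a finite measure on exactly the
    Borel sets of a Polish space: \<open>distr\<close> cuts the sigma-algebra of \<open>M\<close>
    down to the Borel sets, and the indicator makes the measure finite.\<close>
  define \<nu> where "\<nu> = density (distr M borel (\<lambda>x. x)) (indicator (ball x0 R))"
  have [measurable]: "(\<lambda>x. x) \<in> measurable M borel"
    using borel_in_M by (intro measurableI) auto
  have nu: "emeasure \<nu> A = \<mu> (A \<inter> ball x0 R)" if "A \<in> sets borel" for A
  proof -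
    have "emeasure \<nu> A = (\<integral>\<^sup>+ x. indicator (A \<inter> ball x0 R) x \<partial>distr M borel (\<lambda>x. x))"
      unfolding \<nu>_def indicator_inter_arith using that
      by (subst emeasure_density) (simp_all add: mult.commute borel_measurable_indicator)
    also have "\<dots> = \<mu> (A \<inter> ball x0 R)"
      using that by (simp add: emeasure_distr emeasure_M_borel)
    finally show ?thesis .
  qed
  have sets: "sets \<nu> = sets borel" by (simp add: \<nu>_def)
  have "emeasure \<nu> (space \<nu>) \<noteq> \<infinity>" using nu[of UNIV] ball_finite[of x0 R] by (simp add: \<nu>_def)
  from inner_regular[OF sets this B(1)]
  have sup: "emeasure \<nu> B = (SUP K\<in>{K. K \<subseteq> B \<and> compact K}. emeasure \<nu> K)" .
  have "emeasure \<nu> ` {K. K \<subseteq> B \<and> compact K} \<noteq> {}" by blast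
  from ennreal_Sup_countable_SUP[OF this] obtain g :: "nat \<Rightarrow> ennreal" where
    g: "range g \<subseteq> emeasure \<nu> ` {K. K \<subseteq> B \<and> compact K}" "emeasure \<nu> B = (SUP i. g i)"
    using sup by auto
  have "\<forall>n. \<exists>K. K \<subseteq> B \<and> compact K \<and> g n = emeasure \<nu> K" using g(1) by blast
  then obtain C where C: "\<And>n. C n \<subseteq> B" "\<And>n. compact (C n)" "\<And>n. g n = emeasure \<nu> (C n)" by metis
  have Cb: "C n \<in> sets borel" for n by (intro borel_closed compact_imp_closed C(2))
  have b: "(\<Union>n. C n) \<in> sets borel" "B - (\<Union>n. C n) \<in> sets borel" using Cb B(1) by auto
  have "emeasure \<nu> B \<le> emeasure \<nu> (\<Union>n. C n)"
    unfolding g(2) C(3) by (intro SUP_least emeasure_mono) (use b in \<open>auto simp: sets\<close>)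
  moreover have "\<mu> (\<Union>n. C n) \<noteq> \<infinity>" 
    using ball_finite[of x0 R] mu_mono[of "\<Union>n. C n" "ball x0 R"] C(1) B(2) by fastforce
  moreover have "(\<Union>n. C n) \<subseteq> B" using C(1) by blast
  ultimately have "emeasure \<nu> (B - (\<Union>n. C n)) = 0"
    using b B C(1) nu[OF b(1)]
    by (subst emeasure_Diff) (auto simp: sets Int_absorb2 subset_trans[OF _ B(2)] diff_eq_0_iff_ennreal top.not_eq_extremum)
  moreover have "(B - (\<Union>n. C n)) \<inter> ball x0 R = B - (\<Union>n. C n)" using B(2) by auto
  ultimately have "\<mu> (B - (\<Union>n. C n)) = 0" using nu[OF b(2)] by simp
  then show ?thesis using C(1,2) compact_imp_closed by blast
qed

text \<open>Inside a ball, a Borel hull of the complement of \<open>E\<close> has a Borel complement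
  contained in \<open>E\<close>. The two differ by a null set, since the hull has the same finite
  measure as what it covers.\<close>

lemma measurable_sigma_closed:
  assumes E: "E \<in> mu_measurable \<mu>"
  shows "\<exists>\<C>. countable \<C> \<and> (\<forall>C\<in>\<C>. closed C \<and> C \<subseteq> E) \<and> \<mu> (E - \<Union>\<C>) = 0"
proof -
  define x0 :: 'x where "x0 = (SOME x. True)"
  have "\<exists>C :: nat \<Rightarrow> 'x set. (\<forall>n. closed (C n) \<and> C n \<subseteq> E) \<and> \<mu> (E \<inter> ball x0 (real m) - (\<Union>n. C n)) = 0" for m :: nat
  proof -
    define A where "A = ball x0 (real m) - E"
    have "ball x0 (real m) \<in> sets M" using borel_in_M by auto
    then have A: "A \<in> sets M" unfolding A_def using E by (intro sets.Diff) auto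
    obtain H where H: "H \<in> sets borel" "A \<subseteq> H" "\<mu> H = \<mu> A" using borel_hull by blast
    have H': "H \<in> sets M" using H(1) borel_in_M by auto
    have "\<mu> A \<noteq> \<infinity>" using mu_mono[of A "ball x0 (real m)"] ball_finite[of x0 m] by (auto simp: A_def)
    then have "emeasure M (H - A) = 0"
      using A H' H(2,3) by (subst emeasure_Diff) (auto simp: emeasure_M)
    then have HA: "\<mu> (H - A) = 0" using A H' sets.Diff[of H M A] by (auto simp: emeasure_M)
    define B where "B = ball x0 (real m) - H"
    have B: "B \<in> sets borel" "B \<subseteq> ball x0 (real m)" "B \<subseteq> E" using H by (auto simp: B_def A_def)
    obtain C :: "nat \<Rightarrow> 'x set" where C: "\<And>n. closed (C n)" "\<And>n. C n \<subseteq> B" "\<mu> (B - (\<Union>n. C n)) = 0"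
      using borel_sigma_closed[OF B(1,2)] by blast
    have "E \<inter> ball x0 (real m) - (\<Union>n. C n) \<subseteq> (H - A) \<union> (B - (\<Union>n. C n))"
      by (auto simp: A_def B_def)
    then have "\<mu> (E \<inter> ball x0 (real m) - (\<Union>n. C n)) = 0"
      using HA C(3) null_Un null_subset by blast
    then show ?thesis using C B(3) by blast
  qed
  then have "\<forall>m. \<exists>C :: nat \<Rightarrow> 'x set. (\<forall>n. closed (C n) \<and> C n \<subseteq> E) \<and> \<mu> (E \<inter> ball x0 (real m) - (\<Union>n. C n)) = 0"
    by blast
  from choice[OF this] obtain C :: "nat \<Rightarrow> nat \<Rightarrow> 'x set" where
    C: "\<And>m n. closed (C m n)" "\<And>m n. C m n \<subseteq> E" "\<And>m. \<mu> (E \<inter> ball x0 (real m) - (\<Union>n. C m n)) = 0"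
    by blast
  define \<C> where "\<C> = range (\<lambda>(m, n). C m n)"
  have "E - \<Union>\<C> \<subseteq> (\<Union>m. E \<inter> ball x0 (real m) - (\<Union>n. C m n))"
  proof
    fix x assume x: "x \<in> E - \<Union>\<C>"
    obtain m where "dist x0 x < real m" using reals_Archimedean2 by blast
    then show "x \<in> (\<Union>m. E \<inter> ball x0 (real m) - (\<Union>n. C m n))" using x by (auto simp: \<C>_def)
  qed
  moreover have "\<mu> (\<Union>m. E \<inter> ball x0 (real m) - (\<Union>n. C m n)) = 0" by (intro null_UN C) auto
  ultimately have "\<mu> (E - \<Union>\<C>) = 0" by (rule null_subset)
  moreover have "countable \<C>" by (simp add: \<C>_def)
  ultimately show ?thesis using C(1,2) by (intro exI[of _ \<C>]) (auto simp: \<C>_def)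
qed

section \<open>Differentiability of branches\<close>

lemma mu_tendstoD:
  assumes "mu_tendsto \<mu> x S g L" "\<epsilon> > 0"
  obtains U where "mu_nbhd \<mu> x U" "\<And>y. y \<in> U \<Longrightarrow> y \<in> S \<Longrightarrow> y \<noteq> x \<Longrightarrow> \<bar>g y - L\<bar> < \<epsilon>"
proof -
  obtain U where "mu_nbhd \<mu> x U" "\<forall>y\<in>U \<inter> S - {x}. \<bar>g y - L\<bar> < \<epsilon>"
    using assms unfolding mu_tendsto_def by blast
  then show ?thesis by (intro that[of U]) auto
qed

text \<open>\<open>A_set_mu\<close> asks for a finite extended real, so a lower bound is needed too:
  a neighbourhood missing \<open>A - {x}\<close> would contribute an empty supremum, which is minus
  infinity. Accumulation excludes this.\<close>

lemma Lipschitz_in_A_set_mu: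
  fixes g :: "'x \<Rightarrow> 'm::metric_space"
  assumes g: "L-lipschitz_on A g" and x: "x \<in> A" and acc: "mu_accum \<mu> A x"
  shows "x \<in> A_set_mu \<mu> dist A g"
proof -
  let ?q = "\<lambda>y. ereal (dist (g y) (g x) / dist y x)"
  have "0 \<le> mu_limsup \<mu> x A ?q"
    unfolding mu_limsup_def
  proof (rule INF_greatest)
    fix U assume "U \<in> {U. mu_nbhd \<mu> x U}"
    then have "A \<inter> U - {x} \<noteq> {}" using acc unfolding mu_accum_def by blast
    then obtain y where "y \<in> U \<inter> A - {x}" by blast
    then show "0 \<le> (SUP y\<in>U \<inter> A - {x}. ?q y)" by (intro SUP_upper2[of y]) auto
  qed
  moreover have "mu_limsup \<mu> x A ?q \<le> ereal L"
    unfolding mu_limsup_def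
  proof (rule INF_lower2[of UNIV])
    show "(SUP y\<in>UNIV \<inter> A - {x}. ?q y) \<le> ereal L"
    proof (rule SUP_least)
      fix y assume y: "y \<in> UNIV \<inter> A - {x}"
      then have "dist (g y) (g x) \<le> L * dist y x" using lipschitz_onD[OF g _ x] by auto
      then show "?q y \<le> ereal L" using y by (simp add: divide_le_eq)
    qed
  qed (simp add: mu_nbhd_UNIV)
  ultimately have "\<bar>mu_limsup \<mu> x A ?q\<bar> \<noteq> \<infinity>" by auto
  then show ?thesis using x acc by (simp add: A_set_mu_def)
qed

lemma mu_nbhd_closed: "closed A \<Longrightarrow> x \<in> A \<Longrightarrow> thin_at x (- A) \<Longrightarrow> mu_nbhd \<mu> x A"
  by (intro mu_nbhdI) auto

text \<open>\<open>differentiably_complete\<close> speaks about measurable subsets of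
  \<open>A_set_mu\<close>. The density points of \<open>A\<close> that are not isolated in the space
  form such a subset, and the density theorem makes the remaining limit points in \<open>A\<close> a
  null set.\<close>

lemma Lipschitz_ae_differentiable:
  fixes g :: "'x \<Rightarrow> 'm::metric_space"
  assumes D: "differentiably_complete \<mu> D" and A: "closed A" and g: "L-lipschitz_on A g"
  shows "\<mu> {x \<in> A. x islimpt UNIV \<and> \<not> approx_E_differentiable \<mu> D dist A g x} = 0"
proof (cases "A = {}")
  case False
  define N where "N = {x \<in> A. \<not> thin_at x (- A)}"
  have N: "\<mu> N = 0" unfolding N_def by (rule lebesgue_density[OF A])
  define E where "E = A \<inter> {x. x islimpt UNIV} - N"
  have "A \<inter> {x. x islimpt UNIV} \<in> sets M"
    using A closed_limpts by (intro borel_in_M borel_closed closed_Int)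
  moreover have "N \<in> sets M" using measurableI_null[OF N] by simp
  ultimately have "E \<in> sets M" unfolding E_def by (rule sets.Diff)
  then have Em: "E \<in> mu_measurable \<mu>" by simp
  have "E \<subseteq> A_set_mu \<mu> dist A g"
  proof
    fix x assume x: "x \<in> E"
    then have "mu_nbhd \<mu> x A" using A by (intro mu_nbhd_closed) (auto simp: E_def N_def)
    then have "mu_accum \<mu> A x" using x by (intro mu_accumI) (auto simp: E_def)
    then show "x \<in> A_set_mu \<mu> dist A g" using x by (intro Lipschitz_in_A_set_mu[OF g]) (auto simp: E_def)
  qed
  moreover have "ae_on \<mu> (A_set_mu \<mu> dist A g) (approx_E_differentiable \<mu> D dist A g)"
    using D A g False unfolding differentiably_complete_def by blast
  ultimately have "\<mu> {x \<in> E. \<not> approx_E_differentiable \<mu> D dist A g x} = 0"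
    using Em unfolding ae_on_def by blast
  from null_Un[OF this N] show ?thesis by (rule null_subset[rotated]) (auto simp: E_def)
qed simp

text \<open>The common interface of both parts: \<open>D\<close> may consist of germs of either
  kind, so nothing is said about the domains \<open>B i\<close>, and the estimate is restricted to
  their intersection. The condition \<open>U \<subseteq> C\<close> lets the metric case use
  Lipschitz bounds centred at points of \<open>U\<close>.\<close>

definition branches_at ::
  "('x \<times> 'm::metric_space \<times> ('x set \<times> ('x \<Rightarrow> 'm)) set) set \<Rightarrow> nat \<Rightarrow> ('x \<Rightarrow> 'm multiset) \<Rightarrow> 'x set \<Rightarrow> 'x \<Rightarrow>
   (nat \<Rightarrow> 'm) \<Rightarrow> (nat \<Rightarrow> ('x set \<times> ('x \<Rightarrow> 'm)) set) \<Rightarrow> (nat \<Rightarrow> 'x set) \<Rightarrow> (nat \<Rightarrow> 'x \<Rightarrow> 'm) \<Rightarrow> bool" where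
  "branches_at D Q f C x P \<Gamma> B F \<longleftrightarrow> f x = msum Q P \<and>
     (\<forall>i<Q. (x, P i, \<Gamma> i) \<in> D \<and> (B i, F i) \<in> \<Gamma> i) \<and>
     (\<forall>i<Q. \<forall>j<Q. P i = P j \<longrightarrow> \<Gamma> i = \<Gamma> j) \<and>
     (\<forall>\<epsilon>>0. \<exists>U. mu_nbhd \<mu> x U \<and> U \<subseteq> C \<and>
        (\<forall>y\<in>U. (\<forall>i<Q. y \<in> B i) \<longrightarrow> y \<noteq> x \<longrightarrow> Gdist (f y) (msum Q (\<lambda>i. F i y)) < \<epsilon> * dist y x))"

lemma branches_atD:
  assumes "branches_at D Q f C x P \<Gamma> B F"
  shows "f x = msum Q P"
    and "i < Q \<Longrightarrow> (x, P i, \<Gamma> i) \<in> D" and "i < Q \<Longrightarrow> (B i, F i) \<in> \<Gamma> i"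
    and "i < Q \<Longrightarrow> j < Q \<Longrightarrow> P i = P j \<Longrightarrow> \<Gamma> i = \<Gamma> j"
    and "\<epsilon> > 0 \<Longrightarrow> \<exists>U. mu_nbhd \<mu> x U \<and> U \<subseteq> C \<and>
        (\<forall>y\<in>U. (\<forall>i<Q. y \<in> B i) \<longrightarrow> y \<noteq> x \<longrightarrow> Gdist (f y) (msum Q (\<lambda>i. F i y)) < \<epsilon> * dist y x)"
  using assms unfolding branches_at_def by blast+

text \<open>All branches with the same value at \<open>x\<close> receive the germ of one of them. By
  \<open>agree\<close> they are equal on \<open>A\<close>, so that germ approximates each of them
  equally well.\<close>

lemma branches_atI:
  fixes g :: "nat \<Rightarrow> 'x \<Rightarrow> 'm::metric_space"
  assumes A: "mu_nbhd \<mu> x A" "A \<subseteq> C"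
    and f: "\<And>y. y \<in> A \<Longrightarrow> f y = msum Q (\<lambda>i. g i y)"
    and agree: "\<And>i j y. i < Q \<Longrightarrow> j < Q \<Longrightarrow> y \<in> A \<Longrightarrow> g i x = g j x \<Longrightarrow> g i y = g j y"
    and diff: "\<And>i. i < Q \<Longrightarrow> approx_E_differentiable \<mu> D dist A (g i) x"
  shows "\<exists>P \<Gamma> B F. branches_at D Q f C x P \<Gamma> B F"
proof -
  have xA: "x \<in> A" using A(1) by (simp add: mu_nbhd_def)
  have "\<forall>i. \<exists>T. i < Q \<longrightarrow> (x, g i x, fst T) \<in> D \<and> snd T \<in> fst T \<and>
      mu_tendsto \<mu> x (A \<inter> fst (snd T)) (\<lambda>y. dist (g i y) (snd (snd T) y) / dist y x) 0"
  proof
    fix i show "\<exists>T. i < Q \<longrightarrow> (x, g i x, fst T) \<in> D \<and> snd T \<in> fst T \<and>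
      mu_tendsto \<mu> x (A \<inter> fst (snd T)) (\<lambda>y. dist (g i y) (snd (snd T) y) / dist y x) 0"
    proof (cases "i < Q")
      case True
      from diff[OF True] obtain \<Gamma> B F where "(x, g i x, \<Gamma>) \<in> D" "(B, F) \<in> \<Gamma>"
        "mu_tendsto \<mu> x (A \<inter> B) (\<lambda>y. dist (g i y) (F y) / dist y x) 0"
        unfolding approx_E_differentiable_def by blast
      then show ?thesis by (intro exI[of _ "(\<Gamma>, B, F)"]) simp
    qed simp
  qed
  from choice[OF this] obtain T where T: "\<And>i. i < Q \<Longrightarrow> (x, g i x, fst (T i)) \<in> D"
    "\<And>i. i < Q \<Longrightarrow> snd (T i) \<in> fst (T i)"
    "\<And>i. i < Q \<Longrightarrow> mu_tendsto \<mu> x (A \<inter> fst (snd (T i))) (\<lambda>y. dist (g i y) (snd (snd (T i)) y) / dist y x) 0"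
    by blast
  \<comment> \<open>\<open>c i\<close> is the least index whose branch has the value of branch
    \<open>i\<close> at \<open>x\<close>; it depends only on that value, so equal points get equal
    germs.\<close>
  define c where "c i = (LEAST j. g j x = g i x)" for i
  have cx: "g (c i) x = g i x" for i unfolding c_def by (rule LeastI[of _ i]) simp
  have cQ: "c i < Q" if "i < Q" for i
    using Least_le[of "\<lambda>j. g j x = g i x" i] that unfolding c_def by simp
  have cg: "g (c i) y = g i y" if "i < Q" "y \<in> A" for i y
    using agree[OF cQ _ that(2) cx] that by blast
  have ceq: "c i = c j" if "g i x = g j x" for i j using that by (simp add: c_def)
  define B where "B i = fst (snd (T (c i)))" for i
  define F where "F i = snd (snd (T (c i)))" for i
  have near: "\<exists>U. mu_nbhd \<mu> x U \<and> U \<subseteq> C \<and>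
      (\<forall>y\<in>U. (\<forall>i<Q. y \<in> B i) \<longrightarrow> y \<noteq> x \<longrightarrow> Gdist (f y) (msum Q (\<lambda>i. F i y)) < \<epsilon> * dist y x)"
    if e: "\<epsilon> > 0" for \<epsilon>
  proof -
    \<comment> \<open>The \<open>Q\<close> branch errors add up to \<open>Q * \<epsilon>'\<close>,
      strictly below \<open>\<epsilon>\<close>.\<close>
    define \<epsilon>' where "\<epsilon>' = \<epsilon> / (real Q + 1)"
    have e': "\<epsilon>' > 0" "real Q * \<epsilon>' < \<epsilon>" using e by (auto simp: \<epsilon>'_def field_simps)
    have "\<forall>i\<in>{..<Q}. \<exists>U. mu_nbhd \<mu> x U \<and>
        (\<forall>y\<in>U. y \<in> A \<inter> B i \<longrightarrow> y \<noteq> x \<longrightarrow> \<bar>dist (g (c i) y) (F i y) / dist y x - 0\<bar> < \<epsilon>')"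
    proof
      fix i assume "i \<in> {..<Q}"
      then have "mu_tendsto \<mu> x (A \<inter> B i) (\<lambda>y. dist (g (c i) y) (F i y) / dist y x) 0"
        unfolding B_def F_def by (intro T(3) cQ) auto
      from mu_tendstoD[OF this e'(1)] obtain U where "mu_nbhd \<mu> x U"
        "\<And>y. y \<in> U \<Longrightarrow> y \<in> A \<inter> B i \<Longrightarrow> y \<noteq> x \<Longrightarrow> \<bar>dist (g (c i) y) (F i y) / dist y x - 0\<bar> < \<epsilon>'" by blast
      then show "\<exists>U. mu_nbhd \<mu> x U \<and>
        (\<forall>y\<in>U. y \<in> A \<inter> B i \<longrightarrow> y \<noteq> x \<longrightarrow> \<bar>dist (g (c i) y) (F i y) / dist y x - 0\<bar> < \<epsilon>')" by blast
    qed
    from bchoice[OF this] obtain U where U: "\<And>i. i < Q \<Longrightarrow> mu_nbhd \<mu> x (U i)"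
      "\<And>i y. i < Q \<Longrightarrow> y \<in> U i \<Longrightarrow> y \<in> A \<Longrightarrow> y \<in> B i \<Longrightarrow> y \<noteq> x \<Longrightarrow> \<bar>dist (g (c i) y) (F i y) / dist y x - 0\<bar> < \<epsilon>'"
      by auto
    define V where "V = A \<inter> (\<Inter>i\<in>{..<Q}. U i)"
    have "mu_nbhd \<mu> x V" unfolding V_def using U(1) by (intro mu_nbhd_Int A mu_nbhd_INT) auto
    moreover have "Gdist (f y) (msum Q (\<lambda>i. F i y)) < \<epsilon> * dist y x"
      if y: "y \<in> V" "\<forall>i<Q. y \<in> B i" "y \<noteq> x" for y
    proof -
      have d: "dist y x > 0" using y by simp
      have "dist (g i y) (F i y) \<le> \<epsilon>' * dist y x" if "i < Q" for i
        using U(2)[of i y] that y d cg[OF that] by (auto simp: V_def divide_less_eq)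
      then have "(\<Sum>i<Q. dist (g i y) (F i y)) \<le> (\<Sum>i<Q. \<epsilon>' * dist y x)" by (intro sum_mono) auto
      then have "Gdist (msum Q (\<lambda>i. g i y)) (msum Q (\<lambda>i. F i y)) \<le> (\<Sum>i<Q. \<epsilon>' * dist y x)"
        by (rule order_trans[OF Gdist_le_sum])
      also have "\<dots> = real Q * \<epsilon>' * dist y x" by simp
      also have "\<dots> < \<epsilon> * dist y x" using e'(2) d by (rule mult_strict_right_mono)
      finally show ?thesis using f[of y] y(1) by (simp add: V_def)
    qed
    moreover have "V \<subseteq> C" using A(2) by (auto simp: V_def)
    ultimately show ?thesis by blast
  qed
  have "branches_at D Q f C x (\<lambda>i. g i x) (\<lambda>i. fst (T (c i))) B F"
    unfolding branches_at_def
  proof (intro conjI allI impI)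
    show "f x = msum Q (\<lambda>i. g i x)" by (rule f[OF xA])
    fix i assume i: "i < Q"
    show "(x, g i x, fst (T (c i))) \<in> D" using T(1)[OF cQ[OF i]] by (simp add: cx)
    show "(B i, F i) \<in> fst (T (c i))" using T(2)[OF cQ[OF i]] by (simp add: B_def F_def)
    fix j assume "j < Q" "g i x = g j x"
    then show "fst (T (c i)) = fst (T (c j))" using ceq by metis
  next
    fix \<epsilon> :: real assume "\<epsilon> > 0"
    then show "\<exists>U. mu_nbhd \<mu> x U \<and> U \<subseteq> C \<and>
      (\<forall>y\<in>U. (\<forall>i<Q. y \<in> B i) \<longrightarrow> y \<noteq> x \<longrightarrow> Gdist (f y) (msum Q (\<lambda>i. F i y)) < \<epsilon> * dist y x)"
      by (rule near)
  qed
  then show ?thesis by blast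
qed

text \<open>Each piece of the selection loses a null set of non-density points and, for each of the
  \<open>Q\<close> branches, a null set of points without a derivative; there are countably many
  pieces.\<close>

lemma branches_ae:
  fixes f :: "'x \<Rightarrow> 'm::metric_space multiset"
  assumes D: "differentiably_complete \<mu> D" and C: "closed C" and f: "\<And>x. f x \<in> AQ Q" and L: "L \<ge> 0"
    and lip: "\<And>x y. x \<in> C \<Longrightarrow> y \<in> C \<Longrightarrow> Gdist (f x) (f y) \<le> L * dist x y"
  shows "\<mu> {x \<in> C. x islimpt UNIV \<and> (\<nexists>P \<Gamma> B F. branches_at D Q f C x P \<Gamma> B F)} = 0" (is "\<mu> ?X = 0")
proof -
  obtain \<C> where \<C>: "countable \<C>" "\<Union>\<C> = C" "\<And>A. A \<in> \<C> \<Longrightarrow> closed A"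
    and ex: "\<forall>A\<in>\<C>. \<exists>g. (\<forall>y\<in>A. f y = msum Q (\<lambda>i. g i y)) \<and> (\<forall>i<Q. L-lipschitz_on A (g i)) \<and>
       (\<forall>i<Q. \<forall>j<Q. \<forall>x\<in>A. \<forall>y\<in>A. g i x = g j x \<longrightarrow> g i y = g j y)"
    using Lipschitz_selection[where f = f and Q = Q, OF C f L lip] by blast
  from bchoice[OF ex] obtain g where
    G: "\<forall>A\<in>\<C>. (\<forall>y\<in>A. f y = msum Q (\<lambda>i. g A i y)) \<and> (\<forall>i<Q. L-lipschitz_on A (g A i)) \<and>
       (\<forall>i<Q. \<forall>j<Q. \<forall>x\<in>A. \<forall>y\<in>A. g A i x = g A j x \<longrightarrow> g A i y = g A j y)" ..
  have g: "\<And>A y. A \<in> \<C> \<Longrightarrow> y \<in> A \<Longrightarrow> f y = msum Q (\<lambda>i. g A i y)"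
    "\<And>A i. A \<in> \<C> \<Longrightarrow> i < Q \<Longrightarrow> L-lipschitz_on A (g A i)"
    "\<And>A i j x y. A \<in> \<C> \<Longrightarrow> i < Q \<Longrightarrow> j < Q \<Longrightarrow> x \<in> A \<Longrightarrow> y \<in> A \<Longrightarrow> g A i x = g A j x \<Longrightarrow> g A i y = g A j y"
    using G by blast+
  define N where "N A = {x \<in> A. \<not> thin_at x (- A)} \<union>
    (\<Union>i\<in>{..<Q}. {x \<in> A. x islimpt UNIV \<and> \<not> approx_E_differentiable \<mu> D dist A (g A i) x})" for A
  have "\<mu> (N A) = 0" if "A \<in> \<C>" for A
    unfolding N_def using lebesgue_density[OF \<C>(3)[OF that]]
      Lipschitz_ae_differentiable[OF D \<C>(3)[OF that] g(2)[OF that]]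
    by (intro null_Un null_UN) auto
  then have "\<mu> (\<Union>A\<in>\<C>. N A) = 0" using \<C>(1) by (intro null_UN)
  moreover have "?X \<subseteq> (\<Union>A\<in>\<C>. N A)"
  proof
    fix x assume x: "x \<in> ?X"
    then obtain A where A: "A \<in> \<C>" "x \<in> A" using \<C>(2) by blast
    have "x \<in> N A"
    proof (rule ccontr)
      assume nN: "x \<notin> N A"
      have "\<exists>P \<Gamma> B F. branches_at D Q f C x P \<Gamma> B F"
      proof (rule branches_atI)
        show "mu_nbhd \<mu> x A" using nN A \<C>(3) by (intro mu_nbhd_closed) (auto simp: N_def)
        show "A \<subseteq> C" using A(1) \<C>(2) by blast
        show "f y = msum Q (\<lambda>i. g A i y)" if "y \<in> A" for y using g(1)[OF A(1) that] .
        show "g A i y = g A j y" if "i < Q" "j < Q" "y \<in> A" "g A i x = g A j x" for i j y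
          using g(3)[OF A(1) that(1,2) A(2) that(3,4)] .
        show "approx_E_differentiable \<mu> D dist A (g A i) x" if "i < Q" for i
          using nN A(2) x that by (auto simp: N_def)
      qed
      then show False using x by blast
    qed
    then show "x \<in> (\<Union>A\<in>\<C>. N A)" using A(1) by blast
  qed
  ultimately show ?thesis by (rule null_subset[rotated])
qed

text \<open>An arbitrary \<open>y\<close> near \<open>x\<close> is compared with a nearby
  \<open>z\<close> in \<open>U\<close>: from \<open>f y\<close> to \<open>f z\<close> by the
  Lipschitz bound centred at \<open>z\<close>, from \<open>f z\<close> to \<open>FF z\<close> by the
  branch estimate, and from \<open>FF z\<close> to \<open>FF y\<close> by the Lipschitz bound for
  \<open>FF\<close>. The assumption \<open>lip\<close> is one-sided because \<open>y\<close> may lie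
  outside \<open>C\<close>.\<close>

lemma differentiable_from_branches:
  fixes f :: "'x \<Rightarrow> 'm::metric_space multiset"
  assumes D: "X_distribution UNIV dist D" and f: "\<And>x. f x \<in> AQ Q" and x: "x islimpt UNIV"
    and br: "branches_at D Q f C x P \<Gamma> B F" and k: "k \<ge> 0" and R: "R > 0"
    and lip: "\<And>y z. z \<in> C \<Longrightarrow> dist y z < R \<Longrightarrow> Gdist (f y) (f z) \<le> k * dist y z"
  shows "E_differentiable (DQ Q D) Gdist UNIV f x"
proof -
  have germ: "germ_rep UNIV dist x (P i) (B i) (F i)" if "i < Q" for i
  proof -
    have in_D: "(x, P i, \<Gamma> i) \<in> D" and BF: "(B i, F i) \<in> \<Gamma> i"
      using branches_atD(2,3)[OF br that] .
    obtain B0 F0 where "\<Gamma> i = germ_class UNIV dist x (P i) B0 F0"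
      using bspec[OF D[unfolded X_distribution_def] in_D] by auto
    then show ?thesis using BF by (simp add: germ_class_def)
  qed
  have germ_lip: "lip_into UNIV dist (B i) (F i)" if "i < Q" for i using germ[OF that] by (simp add: germ_rep_def)
  have "\<forall>i\<in>{..<Q}. \<exists>r>0. ball x r \<subseteq> B i" using germ by (auto simp: germ_rep_def)
  from bchoice[OF this] obtain r where r: "\<And>i. i < Q \<Longrightarrow> r i > 0" "\<And>i. i < Q \<Longrightarrow> ball x (r i) \<subseteq> B i" by auto
  \<comment> \<open>\<open>insert 1\<close> keeps the minimum defined when there are no
    branches.\<close>
  define r0 where "r0 = Min (insert 1 (r ` {..<Q}))"
  have r0: "r0 > 0" using r(1) by (auto simp: r0_def)
  have r0i: "r0 \<le> r i" if "i < Q" for i using that by (auto simp: r0_def intro!: Min_le)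
  define W where "W = ball x r0"
  have WB: "W \<subseteq> B i" if "i < Q" for i
  proof -
    have "ball x r0 \<subseteq> ball x (r i)" using r0i[OF that] by (rule subset_ball)
    then show ?thesis using r(2)[OF that] by (simp add: W_def)
  qed
  define FF where "FF y = msum Q (\<lambda>i. F i y)" for y
  obtain \<Lambda> where \<Lambda>: "\<Lambda> \<ge> 0" "\<And>y z. y \<in> W \<Longrightarrow> z \<in> W \<Longrightarrow> Gdist (FF y) (FF z) \<le> \<Lambda> * dist y z"
    by (rule msum_Lipschitz[of Q B F W, OF germ_lip WB], assumption, assumption) (rule that, simp_all add: FF_def)
  have FFx: "FF x = f x"
  proof -
    have "FF x = msum Q P" unfolding FF_def using germ by (intro msum_cong) (simp add: germ_rep_def)
    also have "\<dots> = f x" using branches_atD(1)[OF br] by simp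
    finally show ?thesis .
  qed
  have FFA: "FF y \<in> AQ Q" for y unfolding FF_def by (rule msum_in_AQ)
  have rep: "germ_rep (AQ Q) Gdist x (f x) W FF"
    unfolding germ_rep_def
  proof (intro conjI exI[of _ r0])
    show "lip_into (AQ Q) Gdist W FF" unfolding lip_into_def using FFA \<Lambda>(2) by blast
  qed (use r0 FFx in \<open>auto simp: W_def\<close>)
  define G where "G = germ_class (AQ Q) Gdist x (f x) W FF"
  have WG: "(W, FF) \<in> G" unfolding G_def germ_class_def germ_equiv_def using rep by simp
  have "(x, f x, G) \<in> DQ Q D"
  proof -
    have "W \<in> sets borel" "\<exists>r>0. ball x r \<subseteq> W" using r0 by (auto simp: W_def)
    then have "f x = (\<Sum>i<Q. {# P i #}) \<and> (\<forall>i<Q. (x, P i, \<Gamma> i) \<in> D \<and> (B i, F i) \<in> \<Gamma> i) \<and>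
        (\<forall>i<Q. \<forall>j<Q. P i = P j \<longrightarrow> \<Gamma> i = \<Gamma> j) \<and>
        W \<in> sets borel \<and> (\<exists>r>0. ball x r \<subseteq> W) \<and> W \<subseteq> W \<and> (\<forall>i<Q. W \<subseteq> B i) \<and>
        (\<forall>x\<in>W. FF x = (\<Sum>i<Q. {# F i x #}))"
      using branches_atD(1-4)[OF br] WB unfolding FF_def
      by (intro conjI allI impI ballI subset_refl refl)
    with rep WG show ?thesis unfolding DQ_def G_def by blast
  qed
  moreover have "((\<lambda>y. Gdist (f y) (FF y) / dist y x) \<longlongrightarrow> 0) (at x within UNIV \<inter> W)"
  proof (rule tendstoI)
    fix e :: real assume e: "e > 0"
    \<comment> \<open>The two Lipschitz errors together are at most \<open>e / 4 * d\<close>. As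
      \<open>c \<le> 1\<close> gives \<open>dist z x \<le> 2 * d\<close>, the branch error is below
      \<open>e / 2 * d\<close>, and the total stays below \<open>e * d\<close>.\<close>
    define c where "c = min 1 (e / (4 * (k + \<Lambda> + 1)))"
    have c: "0 < c" "c \<le> 1" using e k \<Lambda>(1) by (auto simp: c_def)
    have ck: "(k + \<Lambda>) * c \<le> e / 4"
    proof -
      have "(k + \<Lambda>) * c \<le> (k + \<Lambda> + 1) * (e / (4 * (k + \<Lambda> + 1)))"
        using k \<Lambda>(1) e by (intro mult_mono) (auto simp: c_def)
      also have "\<dots> = e / 4"
      proof -
        have "k + \<Lambda> + 1 > 0" using k \<Lambda>(1) by linarith
        then show ?thesis by (simp add: divide_simps)
      qed
      finally show ?thesis .
    qed
    have "e / 4 > 0" using e by simp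
    then obtain U where U: "mu_nbhd \<mu> x U" "U \<subseteq> C"
      "\<And>y. y \<in> U \<Longrightarrow> (\<forall>i<Q. y \<in> B i) \<Longrightarrow> y \<noteq> x \<Longrightarrow> Gdist (f y) (FF y) < e / 4 * dist y x"
      using branches_atD(5)[OF br] unfolding FF_def by meson
    have "mu_nbhd \<mu> x (U \<inter> W)" unfolding W_def by (intro mu_nbhd_Int U mu_nbhd_ball r0)
    from thin_at_near[OF mu_nbhd_thin[OF this] c] obtain \<delta> where
      \<delta>: "\<delta> > 0" "\<And>y. y \<noteq> x \<Longrightarrow> dist y x < \<delta> \<Longrightarrow> \<exists>z\<in>U \<inter> W. dist z y < c * dist y x" by blast
    have "Gdist (f y) (FF y) / dist y x < e" if y: "y \<in> W" "y \<noteq> x" "dist y x < min \<delta> R" for y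
    proof -
      define d where "d = dist y x"
      have d: "d > 0" using y by (simp add: d_def)
      have cd: "c * d \<le> d" using c d by simp
      obtain z where z: "z \<in> U" "z \<in> W" "dist z y < c * d" using \<delta>(2)[of y] y by (auto simp: d_def)
      have zx: "z \<noteq> x" using z(3) cd by (auto simp: d_def dist_commute)
      have dzx: "dist z x \<le> 2 * d"
        using dist_triangle[of z x y] z(3) cd by (simp add: d_def)
      have zB: "\<forall>i<Q. z \<in> B i" using z(2) WB by blast
      have "dist y z < R" using z(3) cd y(3) by (simp add: d_def dist_commute)
      then have "Gdist (f y) (f z) \<le> k * dist y z"
        using lip[of z y] U(2) z(1) by blast
      also have "\<dots> \<le> k * (c * d)" using z(3) k by (intro mult_left_mono) (auto simp: dist_commute)
      finally have 1: "Gdist (f y) (f z) \<le> k * (c * d)" .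
      have "Gdist (f z) (FF z) < e / 4 * dist z x" using U(3)[OF z(1) zB zx] .
      also have "\<dots> \<le> e / 4 * (2 * d)" using dzx e by (intro mult_left_mono) auto
      finally have 2: "Gdist (f z) (FF z) < e / 4 * (2 * d)" .
      have "Gdist (FF z) (FF y) \<le> \<Lambda> * dist z y" using \<Lambda>(2) z(2) y(1) by blast
      also have "\<dots> \<le> \<Lambda> * (c * d)" using z(3) \<Lambda>(1) by (intro mult_left_mono) auto
      finally have 3: "Gdist (FF z) (FF y) \<le> \<Lambda> * (c * d)" .
      have "Gdist (f y) (FF y) \<le> Gdist (f y) (f z) + (Gdist (f z) (FF z) + Gdist (FF z) (FF y))"
        using Gdist_triangle[OF f f FFA, of y y z] Gdist_triangle[OF f FFA FFA, of z y z] by linarith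
      also have "\<dots> < (k + \<Lambda>) * c * d + e / 4 * (2 * d)"
        using 1 2 3 by (simp add: algebra_simps)
      also have "\<dots> \<le> e / 4 * d + e / 4 * (2 * d)"
        using ck d by (intro add_right_mono mult_right_mono) auto
      also have "\<dots> < e * d" using e d by (simp add: field_simps)
      finally show ?thesis using d by (simp add: d_def divide_less_eq)
    qed
    moreover have "0 \<le> Gdist (f y) (FF y)" for y
      using Gdist_nonneg[OF f FFA] .
    ultimately show "\<forall>\<^sub>F y in at x within UNIV \<inter> W. dist (Gdist (f y) (FF y) / dist y x) 0 < e"
      unfolding eventually_at using \<delta>(1) R
      by (intro exI[of _ "min \<delta> R"]) (auto simp: abs_of_nonneg)
  qed
  ultimately show ?thesis
    unfolding E_differentiable_def using x WG by (intro conjI exI[of _ G]) auto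
qed

text \<open>The domains \<open>B i\<close> are only \<open>\<mu>\<close>-neighbourhoods, so a Borel
  one inside their intersection replaces the ball of the metric case. The branch estimate on it is
  already the required limit.\<close>

lemma approx_differentiable_from_branches:
  fixes f :: "'x \<Rightarrow> 'm::metric_space multiset"
  assumes D: "approx_X_distribution \<mu> UNIV dist D" and f: "\<And>x. f x \<in> AQ Q" and x: "x islimpt UNIV"
    and br: "branches_at D Q f C x P \<Gamma> B F"
  shows "approx_E_differentiable \<mu> (DQ_approx \<mu> Q D) Gdist UNIV f x"
proof -
  have germ: "agerm_rep \<mu> UNIV dist x (P i) (B i) (F i)" if "i < Q" for i
  proof -
    have in_D: "(x, P i, \<Gamma> i) \<in> D" and BF: "(B i, F i) \<in> \<Gamma> i"
      using branches_atD(2,3)[OF br that] .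
    obtain B0 F0 where "\<Gamma> i = agerm_class \<mu> UNIV dist x (P i) B0 F0"
      using bspec[OF D[unfolded approx_X_distribution_def] in_D] by auto
    then show ?thesis using BF by (simp add: agerm_class_def)
  qed
  have germ_lip: "lip_into UNIV dist (B i) (F i)" if "i < Q" for i using germ[OF that] by (simp add: agerm_rep_def)
  have "mu_nbhd \<mu> x (\<Inter>i\<in>{..<Q}. B i)" using germ by (intro mu_nbhd_INT) (auto simp: agerm_rep_def)
  then obtain W where W: "W \<in> sets borel" "W \<subseteq> (\<Inter>i\<in>{..<Q}. B i)" "mu_nbhd \<mu> x W"
    by (rule mu_nbhd_borel)
  have WB: "W \<subseteq> B i" if "i < Q" for i using W(2) that by blast
  define FF where "FF y = msum Q (\<lambda>i. F i y)" for y
  obtain \<Lambda> where \<Lambda>: "\<Lambda> \<ge> 0" "\<And>y z. y \<in> W \<Longrightarrow> z \<in> W \<Longrightarrow> Gdist (FF y) (FF z) \<le> \<Lambda> * dist y z"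
    by (rule msum_Lipschitz[of Q B F W, OF germ_lip WB], assumption, assumption) (rule that, simp_all add: FF_def)
  have FFx: "FF x = f x"
  proof -
    have "FF x = msum Q P" unfolding FF_def using germ by (intro msum_cong) (simp add: agerm_rep_def)
    also have "\<dots> = f x" using branches_atD(1)[OF br] by simp
    finally show ?thesis .
  qed
  have FFA: "FF y \<in> AQ Q" for y unfolding FF_def by (rule msum_in_AQ)
  have rep: "agerm_rep \<mu> (AQ Q) Gdist x (f x) W FF"
    unfolding agerm_rep_def lip_into_def using FFA \<Lambda>(2) FFx W(3) by auto
  define G where "G = agerm_class \<mu> (AQ Q) Gdist x (f x) W FF"
  have WG: "(W, FF) \<in> G"
    unfolding G_def agerm_class_def agerm_equiv_def mu_tendsto_def using rep mu_nbhd_UNIV by auto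
  have "(x, f x, G) \<in> DQ_approx \<mu> Q D"
  proof -
    have "f x = (\<Sum>i<Q. {# P i #}) \<and> (\<forall>i<Q. (x, P i, \<Gamma> i) \<in> D \<and> (B i, F i) \<in> \<Gamma> i) \<and>
        (\<forall>i<Q. \<forall>j<Q. P i = P j \<longrightarrow> \<Gamma> i = \<Gamma> j) \<and>
        W \<in> sets borel \<and> mu_nbhd \<mu> x W \<and> W \<subseteq> W \<and> (\<forall>i<Q. W \<subseteq> B i) \<and>
        (\<forall>x\<in>W. FF x = (\<Sum>i<Q. {# F i x #}))"
      using branches_atD(1-4)[OF br] WB W unfolding FF_def
      by (intro conjI allI impI ballI subset_refl refl)
    with rep WG show ?thesis unfolding DQ_approx_def G_def by blast
  qed
  moreover have "mu_tendsto \<mu> x (UNIV \<inter> W) (\<lambda>y. Gdist (f y) (FF y) / dist y x) 0"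
    unfolding mu_tendsto_def
  proof (intro allI impI)
    fix e :: real assume "e > 0"
    then obtain U where U: "mu_nbhd \<mu> x U"
      "\<And>y. y \<in> U \<Longrightarrow> (\<forall>i<Q. y \<in> B i) \<Longrightarrow> y \<noteq> x \<Longrightarrow> Gdist (f y) (FF y) < e * dist y x"
      using branches_atD(5)[OF br] unfolding FF_def by meson
    have "\<bar>Gdist (f y) (FF y) / dist y x - 0\<bar> < e" if "y \<in> U \<inter> (UNIV \<inter> W) - {x}" for y
    proof -
      have "Gdist (f y) (FF y) < e * dist y x" using U(2)[of y] that WB by blast
      moreover have "0 \<le> Gdist (f y) (FF y)" using f FFA by (rule Gdist_nonneg)
      ultimately show ?thesis using that by (simp add: divide_less_eq)
    qed
    then show "\<exists>U. mu_nbhd \<mu> x U \<and> (\<forall>y\<in>U \<inter> (UNIV \<inter> W) - {x}. \<bar>Gdist (f y) (FF y) / dist y x - 0\<bar> < e)"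
      using U(1) by blast
  qed
  moreover have "mu_accum \<mu> UNIV x" by (rule mu_accumI[OF mu_nbhd_UNIV x])
  ultimately show ?thesis
    unfolding approx_E_differentiable_def using WG by (intro conjI exI[of _ G]) auto
qed

section \<open>Countable decomposition into Lipschitz pieces\<close>

text \<open>The set measured here need not be measurable, as \<open>f\<close> is arbitrary. The constant is chosen such
  that at two such points \<open>x\<close>, \<open>y\<close> the exceptional sets together do not fill \<open>ball x (dist x y)\<close>.\<close>
definition approx_lipschitz_at :: "('x \<Rightarrow> 'm::metric_space multiset) \<Rightarrow> 'x \<Rightarrow> real \<Rightarrow> real \<Rightarrow> bool" where
  "approx_lipschitz_at f x k R \<longleftrightarrow> (\<forall>r. 0 < r \<longrightarrow> r < R \<longrightarrow>
     \<mu> (ball x r - {y. Gdist (f y) (f x) \<le> k * dist y x}) \<le> ennreal (inverse (2 * (1 + K\<^sup>2))) * \<mu> (ball x r))"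

text \<open>Through the inclusions of \<open>ball x d\<close> in \<open>ball y (2 * d)\<close> and
  of the latter in \<open>ball x (4 * d)\<close>, the two exceptional sets fill at most half of
  \<open>ball x d\<close>. Any remaining \<open>z\<close> links \<open>f x\<close> to
  \<open>f y\<close>, with \<open>dist z y \<le> 2 * d\<close> producing the factor
  \<open>2\<close>. Only monotonicity and subadditivity enter. The two points keep separate
  constants for the passage to the closure.\<close>

lemma approx_lipschitz_pair:
  fixes f :: "'x \<Rightarrow> 'm::metric_space multiset"
  assumes f: "\<And>x. f x \<in> AQ Q" and x: "approx_lipschitz_at f x k R" and y: "approx_lipschitz_at f y l S"
    and kl: "k \<ge> 0" "l \<ge> 0" and xy: "dist x y < R" "2 * dist x y < S"
  shows "Gdist (f x) (f y) \<le> (k + 2 * l) * dist x y"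
proof (cases "x = y")
  case False
  define d where "d = dist x y"
  have d: "d > 0" using False by (simp add: d_def)
  define gx where "gx = {z. Gdist (f z) (f x) \<le> k * dist z x}"
  define gy where "gy = {z. Gdist (f z) (f y) \<le> l * dist z y}"
  define \<eta> where "\<eta> = inverse (2 * (1 + K\<^sup>2))"
  have \<eta>: "\<eta> > 0" unfolding \<eta>_def using K_pos by (simp add: add_pos_nonneg)
  obtain m where m: "\<mu> (ball x d) = ennreal m" "m > 0"
    using ball_pos[OF d, of x] ball_finite[of x d] by (cases "\<mu> (ball x d)") auto
  have bx: "\<mu> (ball x d - gx) \<le> ennreal \<eta> * ennreal m"
    using x d xy(1) unfolding approx_lipschitz_at_def gx_def \<eta>_def d_def[symmetric] m(1)[symmetric] by blast
  have "\<mu> (ball x d - gy) \<le> \<mu> (ball y (2 * d) - gy)"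
  proof (rule mu_mono, rule)
    fix z assume "z \<in> ball x d - gy"
    then show "z \<in> ball y (2 * d) - gy"
      using dist_triangle[of y z x] by (auto simp: d_def dist_commute)
  qed
  also have "\<dots> \<le> ennreal \<eta> * \<mu> (ball y (2 * d))"
    using y d xy(2) unfolding approx_lipschitz_at_def gy_def \<eta>_def d_def[symmetric] by simp
  also have "\<dots> \<le> ennreal \<eta> * \<mu> (ball x (4 * d))"
  proof (intro mult_left_mono mu_mono subsetI)
    fix z assume "z \<in> ball y (2 * d)"
    then have "dist y z < 2 * d" by simp
    then have "dist x z < 4 * d" using dist_triangle[of x z y] d d_def by linarith
    then show "z \<in> ball x (4 * d)" by simp
  qed simp
  also have "\<dots> \<le> ennreal \<eta> * (ennreal (K\<^sup>2) * ennreal m)"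
    unfolding m(1)[symmetric] by (intro mult_left_mono ball_double2) simp
  finally have by': "\<mu> (ball x d - gy) \<le> ennreal \<eta> * (ennreal (K\<^sup>2) * ennreal m)" .
  have "\<exists>z\<in>ball x d. z \<in> gx \<and> z \<in> gy"
  proof (rule ccontr)
    assume "\<not> ?thesis"
    then have "ball x d \<subseteq> (ball x d - gx) \<union> (ball x d - gy)" by blast
    then have "ennreal m \<le> \<mu> ((ball x d - gx) \<union> (ball x d - gy))" unfolding m(1)[symmetric] by (rule mu_mono)
    also have "\<dots> \<le> ennreal \<eta> * ennreal m + ennreal \<eta> * (ennreal (K\<^sup>2) * ennreal m)"
      by (intro order_trans[OF mu_Un_le] add_mono bx by')
    also have "\<dots> = ennreal (\<eta> * m + \<eta> * (K\<^sup>2 * m))"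
      using \<eta> m(2) by (simp add: ennreal_mult ennreal_plus)
    finally have "m \<le> \<eta> * m + \<eta> * (K\<^sup>2 * m)" using \<eta> m(2) by (subst (asm) ennreal_le_iff) auto
    also have "\<dots> = (\<eta> * (1 + K\<^sup>2)) * m" by (simp add: algebra_simps)
    also have "\<eta> * (1 + K\<^sup>2) = 1 / 2"
    proof -
      have "1 + K\<^sup>2 > 0" by (simp add: add_pos_nonneg)
      then show ?thesis by (simp add: \<eta>_def field_simps)
    qed
    finally show False using m(2) by simp
  qed
  then obtain z where z: "dist x z < d" "Gdist (f z) (f x) \<le> k * dist z x" "Gdist (f z) (f y) \<le> l * dist z y"
    by (auto simp: gx_def gy_def)
  have "dist z y \<le> 2 * d" using dist_triangle[of z y x] z(1) by (simp add: d_def dist_commute)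
  then have "l * dist z y \<le> l * (2 * d)" using kl by (intro mult_left_mono)
  moreover have "k * dist z x \<le> k * d" using z(1) kl by (intro mult_left_mono) (auto simp: dist_commute)
  moreover have "Gdist (f x) (f y) \<le> Gdist (f z) (f x) + Gdist (f z) (f y)"
    using Gdist_triangle[OF f f f, of x y z] Gdist_commute[OF f f, of x z] by simp
  ultimately show ?thesis using z(2,3) by (simp add: d_def algebra_simps)
qed simp

lemma A_set_mu_approx_lipschitz:
  fixes f :: "'x \<Rightarrow> 'm::metric_space multiset"
  assumes f: "\<And>x. f x \<in> AQ Q" and x: "x \<in> A_set_mu \<mu> Gdist UNIV f"
  shows "\<exists>n. approx_lipschitz_at f x (real n) (inverse (real (Suc n)))"
proof -
  let ?q = "\<lambda>y. ereal (Gdist (f y) (f x) / dist y x)"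
  have "mu_limsup \<mu> x UNIV ?q < \<infinity>" using x by (auto simp: A_set_mu_def)
  then obtain U where U: "mu_nbhd \<mu> x U" "(SUP y\<in>U \<inter> UNIV - {x}. ?q y) < \<infinity>"
    unfolding mu_limsup_def INF_less_iff by blast
  obtain c where c: "(SUP y\<in>U \<inter> UNIV - {x}. ?q y) \<le> ereal (real c)"
  proof (cases "SUP y\<in>U \<inter> UNIV - {x}. ?q y")
    case (real s)
    obtain c where "s \<le> real c" using real_arch_simple by blast
    then show ?thesis using real by (intro that[of c]) simp
  qed (use U(2) that[of 0] in auto)
  have gU: "Gdist (f y) (f x) \<le> real c * dist y x" if "y \<in> U" for y
  proof (cases "y = x")
    case False
    then have "?q y \<le> ereal (real c)" using that by (intro order_trans[OF SUP_upper c]) auto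
    then show ?thesis using False by (simp add: divide_le_eq)
  qed simp
  have "inverse (2 * (1 + K\<^sup>2)) > 0" by (simp add: add_pos_nonneg)
  then obtain \<delta> where \<delta>: "\<delta> > 0"
    "\<And>r. 0 < r \<Longrightarrow> r < \<delta> \<Longrightarrow> \<mu> (ball x r \<inter> - U) \<le> ennreal (inverse (2 * (1 + K\<^sup>2))) * \<mu> (ball x r)"
    using mu_nbhd_thin[OF U(1)] unfolding thin_at_def by blast
  obtain n where n: "inverse (real (Suc n)) < \<delta>" using reals_Archimedean[OF \<delta>(1)] by blast
  \<comment> \<open>A larger index weakens the Lipschitz bound and shrinks the radius, so one
    integer can serve for both.\<close>
  define N where "N = max c n"
  have "inverse (real (Suc N)) \<le> inverse (real (Suc n))" by (intro le_imp_inverse_le) (auto simp: N_def)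
  with n have N: "inverse (real (Suc N)) < \<delta>" by linarith
  have "approx_lipschitz_at f x (real N) (inverse (real (Suc N)))"
    unfolding approx_lipschitz_at_def
  proof (intro allI impI)
    fix r assume r: "0 < r" "r < inverse (real (Suc N))"
    have "Gdist (f y) (f x) \<le> real N * dist y x" if "y \<in> U" for y
    proof -
      have "real c * dist y x \<le> real N * dist y x" by (intro mult_right_mono) (auto simp: N_def)
      with gU[OF that] show ?thesis by linarith
    qed
    then have "ball x r - {y. Gdist (f y) (f x) \<le> real N * dist y x} \<subseteq> ball x r \<inter> - U" by blast
    then have "\<mu> (ball x r - {y. Gdist (f y) (f x) \<le> real N * dist y x}) \<le> \<mu> (ball x r \<inter> - U)" by (rule mu_mono)
    also have "\<dots> \<le> ennreal (inverse (2 * (1 + K\<^sup>2))) * \<mu> (ball x r)" using r N by (intro \<delta>(2)) auto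
    finally show "\<mu> (ball x r - {y. Gdist (f y) (f x) \<le> real N * dist y x}) \<le> ennreal (inverse (2 * (1 + K\<^sup>2))) * \<mu> (ball x r)" .
  qed
  then show ?thesis by blast
qed

text \<open>A limit point \<open>z\<close> has a constant of its own, unrelated to \<open>k\<close>.
  It enters only through the term \<open>c * dist z (X n)\<close>, which vanishes in the limit,
  while pairs from \<open>S\<close> obey the uniform constant \<open>k + 2 * k\<close>.\<close>

lemma approx_lipschitz_closure:
  fixes f :: "'x \<Rightarrow> 'm::metric_space multiset"
  assumes f: "\<And>x. f x \<in> AQ Q" and k: "k \<ge> 0"
    and S: "\<And>x. x \<in> S \<Longrightarrow> approx_lipschitz_at f x k R" "\<And>x y. x \<in> S \<Longrightarrow> y \<in> S \<Longrightarrow> 2 * dist x y < R" and R: "R > 0"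
    and x: "x \<in> closure S" "x \<in> A_set_mu \<mu> Gdist UNIV f"
    and y: "y \<in> closure S" "y \<in> A_set_mu \<mu> Gdist UNIV f"
  shows "Gdist (f x) (f y) \<le> 3 * k * dist x y"
proof -
  have approx: "\<exists>X c. (\<forall>n. X n \<in> S) \<and> X \<longlonglongrightarrow> z \<and> (\<forall>\<^sub>F n in sequentially. Gdist (f z) (f (X n)) \<le> c * dist z (X n))"
    if z: "z \<in> closure S" "z \<in> A_set_mu \<mu> Gdist UNIV f" for z
  proof -
    obtain X where X: "\<And>n. X n \<in> S" "X \<longlonglongrightarrow> z" using z(1) unfolding closure_sequential by blast
    obtain n where n: "approx_lipschitz_at f z (real n) (inverse (real (Suc n)))" using A_set_mu_approx_lipschitz[OF f z(2)] by blast
    have "min (inverse (real (Suc n))) (R / 2) > 0" using R by simp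
    with X(2) have "\<forall>\<^sub>F i in sequentially. dist (X i) z < min (inverse (real (Suc n))) (R / 2)" by (rule tendstoD)
    then have "\<forall>\<^sub>F i in sequentially. Gdist (f z) (f (X i)) \<le> (real n + 2 * k) * dist z (X i)"
    proof eventually_elim
      case (elim i)
      then show ?case using X(1) k by (intro approx_lipschitz_pair[OF f n S(1)]) (auto simp: dist_commute)
    qed
    then show ?thesis using X by blast
  qed
  obtain X c where X: "\<And>n. X n \<in> S" "X \<longlonglongrightarrow> x" "\<forall>\<^sub>F n in sequentially. Gdist (f x) (f (X n)) \<le> c * dist x (X n)"
    using approx[OF x] by blast
  obtain Y c' where Y: "\<And>n. Y n \<in> S" "Y \<longlonglongrightarrow> y" "\<forall>\<^sub>F n in sequentially. Gdist (f y) (f (Y n)) \<le> c' * dist y (Y n)"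
    using approx[OF y] by blast
  have lim: "(\<lambda>n. c * dist x (X n) + 3 * k * dist (X n) (Y n) + c' * dist y (Y n)) \<longlonglongrightarrow>
      c * dist x x + 3 * k * dist x y + c' * dist y y"
    using X(2) Y(2) by (intro tendsto_intros)
  have "\<forall>\<^sub>F n in sequentially. Gdist (f x) (f y) \<le> c * dist x (X n) + 3 * k * dist (X n) (Y n) + c' * dist y (Y n)"
    using X(3) Y(3)
  proof eventually_elim
    case (elim n)
    have "dist (X n) (Y n) < R" using S(2)[OF X(1) Y(1), of n n] R zero_le_dist[of "X n" "Y n"] by linarith
    then have "Gdist (f (X n)) (f (Y n)) \<le> (k + 2 * k) * dist (X n) (Y n)"
      using S X(1) Y(1) k
      by (intro approx_lipschitz_pair[where f = f and Q = Q and k = k and l = k and R = R and S = R, OF f]) auto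
    moreover have "Gdist (f x) (f y) \<le> Gdist (f x) (f (X n)) + (Gdist (f (X n)) (f (Y n)) + Gdist (f y) (f (Y n)))"
      using Gdist_triangle[OF f f f, of x y "X n"] Gdist_triangle[OF f f f, of "X n" y "Y n"]
        Gdist_commute[OF f f, of "Y n" y] by linarith
    ultimately show ?case using elim by (simp add: algebra_simps)
  qed
  then have "Gdist (f x) (f y) \<le> c * dist x x + 3 * k * dist x y + c' * dist y y"
    by (intro tendsto_lowerbound[OF lim]) auto
  then show ?thesis by simp
qed

section \<open>Points of finite metric slope, and the two differentiability theorems\<close>

lemma A_set_locally_Lipschitz:
  fixes f :: "'x \<Rightarrow> 'm::metric_space multiset"
  assumes x: "x \<in> A_set Gdist UNIV f"
  shows "\<exists>n. \<forall>y. dist y x < inverse (real (Suc n)) \<longrightarrow> Gdist (f y) (f x) \<le> real n * dist y x"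
proof -
  let ?q = "\<lambda>y. ereal (Gdist (f y) (f x) / dist y x)"
  have fin: "\<bar>Limsup (at x) ?q\<bar> \<noteq> \<infinity>" using x by (simp add: A_set_def)
  then obtain s where s: "Limsup (at x) ?q = ereal s" by auto
  obtain c where c: "s < real c" using reals_Archimedean2 by blast
  have "\<forall>\<^sub>F y in at x. ?q y < ereal (real c)" using s c by (intro Limsup_lessD) simp
  then obtain \<delta> where \<delta>: "\<delta> > 0" "\<And>y. y \<noteq> x \<Longrightarrow> dist y x < \<delta> \<Longrightarrow> ?q y < ereal (real c)"
    unfolding eventually_at by auto
  obtain n where n: "inverse (real (Suc n)) < \<delta>" using reals_Archimedean[OF \<delta>(1)] by blast
  define N where "N = max c n"
  have "inverse (real (Suc N)) \<le> inverse (real (Suc n))" by (intro le_imp_inverse_le) (auto simp: N_def)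
  with n have N: "inverse (real (Suc N)) < \<delta>" by linarith
  have "Gdist (f y) (f x) \<le> real N * dist y x" if y: "dist y x < inverse (real (Suc N))" for y
  proof (cases "y = x")
    case False
    then have "Gdist (f y) (f x) / dist y x < real c" using \<delta>(2)[of y] y N by simp
    then have "Gdist (f y) (f x) \<le> real c * dist y x" using False by (simp add: divide_less_eq)
    also have "\<dots> \<le> real N * dist y x" by (intro mult_right_mono) (auto simp: N_def)
    finally show ?thesis .
  qed simp
  then show ?thesis by blast
qed

text \<open>The bound centred at \<open>X n\<close> is evaluated both at \<open>y\<close> and at the
  limit \<open>x\<close>; the second evaluation is what brings \<open>f (X n)\<close> close to
  \<open>f x\<close>.\<close>

lemma closed_locally_Lipschitz:
  fixes f :: "'x \<Rightarrow> 'm::metric_space multiset"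
  assumes f: "\<And>x. f x \<in> AQ Q" and R: "R > 0"
  shows "closed {x. \<forall>y. dist y x < R \<longrightarrow> Gdist (f y) (f x) \<le> k * dist y x}"
  unfolding closed_sequential_limits
proof (intro allI impI, elim conjE)
  fix X x assume X: "\<forall>n. X n \<in> {x. \<forall>y. dist y x < R \<longrightarrow> Gdist (f y) (f x) \<le> k * dist y x}" and lim: "X \<longlonglongrightarrow> x"
  have "Gdist (f y) (f x) \<le> k * dist y x" if y: "dist y x < R" for y
  proof -
    have lim1: "(\<lambda>n. k * dist y (X n) + k * dist x (X n)) \<longlonglongrightarrow> k * dist y x + k * dist x x"
      using lim by (intro tendsto_intros)
    have "(\<lambda>n. dist y (X n)) \<longlonglongrightarrow> dist y x" "(\<lambda>n. dist x (X n)) \<longlonglongrightarrow> dist x x"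
      by (rule tendsto_dist[OF tendsto_const lim])+
    then have "\<forall>\<^sub>F n in sequentially. dist y (X n) < R" "\<forall>\<^sub>F n in sequentially. dist x (X n) < R"
      using y R by (auto intro: order_tendstoD)
    then have "\<forall>\<^sub>F n in sequentially. Gdist (f y) (f x) \<le> k * dist y (X n) + k * dist x (X n)"
    proof eventually_elim
      case (elim n)
      then have "Gdist (f y) (f (X n)) \<le> k * dist y (X n)" "Gdist (f x) (f (X n)) \<le> k * dist x (X n)"
        using X by auto
      then show ?case
        using Gdist_triangle[OF f f f, of y x "X n"] Gdist_commute[OF f f, of x "X n"] by linarith
    qed
    then have "Gdist (f y) (f x) \<le> k * dist y x + k * dist x x" by (intro tendsto_lowerbound[OF lim1]) auto
    then show ?thesis by simp
  qed
  then show "x \<in> {x. \<forall>y. dist y x < R \<longrightarrow> Gdist (f y) (f x) \<le> k * dist y x}" by blast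
qed

text \<open>The bound defining \<open>A n\<close> is centred in the set but tests every nearby point
  of the space. This makes the pieces closed from the outset and is exactly the one-sided bound that
  \<open>differentiable_from_branches\<close> asks for.\<close>

theorem ae_differentiable:
  fixes f :: "'x \<Rightarrow> 'm::metric_space multiset"
  assumes XD: "X_distribution UNIV dist D" and D: "differentiably_complete \<mu> D" and f: "\<And>x. f x \<in> AQ Q"
  shows "ae_on \<mu> (A_set Gdist UNIV f) (E_differentiable (DQ Q D) Gdist UNIV f)"
  unfolding ae_on_def
proof (intro allI impI)
  fix E assume E: "E \<subseteq> A_set Gdist UNIV f"
  obtain Z :: "'x set" where Z: "countable Z" "\<And>X. open X \<Longrightarrow> X \<noteq> {} \<Longrightarrow> \<exists>d\<in>Z. d \<in> X"
    using countable_dense_exists by blast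
  define R where "R n = inverse (real (Suc n))" for n
  have R: "R n > 0" for n by (simp add: R_def)
  define A where "A n = {x. \<forall>y. dist y x < R n \<longrightarrow> Gdist (f y) (f x) \<le> real n * dist y x}" for n
  \<comment> \<open>Two points of such a ball are less than \<open>R n\<close> apart, within reach
    of the bound centred at either.\<close>
  define C where "C n d = A n \<inter> cball d (R n / 3)" for n d
  have C: "closed (C n d)" for n d
    unfolding C_def A_def by (intro closed_Int closed_cball closed_locally_Lipschitz[OF f R])
  have lip: "Gdist (f x) (f y) \<le> real n * dist x y" if "x \<in> C n d" "y \<in> C n d" for n d x y
  proof -
    have "dist x y < R n" using dist_triangle3[of x y d] that R[of n] by (auto simp: C_def)
    then show ?thesis using that by (auto simp: C_def A_def)
  qed
  define N where "N n d = {x \<in> C n d. x islimpt UNIV \<and> (\<nexists>P \<Gamma> B F. branches_at D Q f (C n d) x P \<Gamma> B F)}" for n d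
  have "\<mu> (N n d) = 0" for n d
    unfolding N_def by (rule branches_ae[OF D C f _ lip]) auto
  then have "\<mu> (\<Union>n. \<Union>d\<in>Z. N n d) = 0" using Z(1) by (intro null_UN) auto
  moreover have "{x \<in> E. \<not> E_differentiable (DQ Q D) Gdist UNIV f x} \<subseteq> (\<Union>n. \<Union>d\<in>Z. N n d)"
  proof
    fix x assume x: "x \<in> {x \<in> E. \<not> E_differentiable (DQ Q D) Gdist UNIV f x}"
    then have xA: "x \<in> A_set Gdist UNIV f" using E by blast
    then have acc: "x islimpt UNIV" by (simp add: A_set_def)
    obtain n where n: "x \<in> A n" using A_set_locally_Lipschitz[OF xA] by (auto simp: A_def R_def)
    obtain d where d: "d \<in> Z" "d \<in> ball x (R n / 3)" using Z(2)[of "ball x (R n / 3)"] R[of n] by auto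
    have xC: "x \<in> C n d" using n d(2) by (auto simp: C_def dist_commute)
    have "\<nexists>P \<Gamma> B F. branches_at D Q f (C n d) x P \<Gamma> B F"
    proof
      assume "\<exists>P \<Gamma> B F. branches_at D Q f (C n d) x P \<Gamma> B F"
      then obtain P \<Gamma> B F where "branches_at D Q f (C n d) x P \<Gamma> B F" by blast
      from differentiable_from_branches[OF XD f acc this, of "real n" "R n"] R
      have "E_differentiable (DQ Q D) Gdist UNIV f x" by (auto simp: C_def A_def)
      then show False using x by blast
    qed
    then have "x \<in> N n d" using xC acc by (simp add: N_def)
    then show "x \<in> (\<Union>n. \<Union>d\<in>Z. N n d)" using d(1) by blast
  qed
  ultimately show "\<mu> {x \<in> E. \<not> E_differentiable (DQ Q D) Gdist UNIV f x} = 0" by (rule null_subset[rotated])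
qed

theorem ae_approx_differentiable:
  fixes f :: "'x \<Rightarrow> 'm::metric_space multiset"
  assumes XD: "approx_X_distribution \<mu> UNIV dist D" and D: "differentiably_complete \<mu> D" and f: "\<And>x. f x \<in> AQ Q"
  shows "ae_on \<mu> (A_set_mu \<mu> Gdist UNIV f) (approx_E_differentiable \<mu> (DQ_approx \<mu> Q D) Gdist UNIV f)"
  unfolding ae_on_def
proof (intro allI impI)
  fix E assume E: "E \<subseteq> A_set_mu \<mu> Gdist UNIV f" "E \<in> mu_measurable \<mu>"
  let ?P = "approx_E_differentiable \<mu> (DQ_approx \<mu> Q D) Gdist UNIV f"
  obtain Z :: "'x set" where Z: "countable Z" "\<And>X. open X \<Longrightarrow> X \<noteq> {} \<Longrightarrow> \<exists>d\<in>Z. d \<in> X"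
    using countable_dense_exists by blast
  define R where "R n = inverse (real (Suc n))" for n
  have R: "R n > 0" for n by (simp add: R_def)
  \<comment> \<open>In a ball of radius \<open>R n / 5\<close> twice any distance is below
    \<open>R n\<close>, as the comparison of two points requires.\<close>
  define S where "S n d = {x. approx_lipschitz_at f x (real n) (R n)} \<inter> ball d (R n / 5)" for n d
  \<comment> \<open>\<open>S n d\<close> may be non-measurable; its closure restores measurability,
    and intersecting with \<open>E\<close> keeps only points of \<open>A_set_mu\<close>, where the
    Lipschitz bound survives.\<close>
  define T where "T n d = E \<inter> closure (S n d)" for n d
  have lip: "Gdist (f x) (f y) \<le> 3 * real n * dist x y" if "x \<in> T n d" "y \<in> T n d" for n d x y
  proof (rule approx_lipschitz_closure[where f = f and Q = Q and k = "real n" and S = "S n d" and R = "R n", OF f])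
    fix x y assume "x \<in> S n d" "y \<in> S n d"
    then show "2 * dist x y < R n" using dist_triangle3[of x y d] R[of n] by (auto simp: S_def)
  qed (use that E(1) R in \<open>auto simp: T_def S_def\<close>)
  have null: "\<mu> {x \<in> T n d. \<not> ?P x} = 0" for n d
  proof -
    have "E \<in> sets M" using E(2) by simp
    moreover have "closure (S n d) \<in> sets M" by (intro borel_in_M) simp
    ultimately have "T n d \<in> sets M" unfolding T_def by (rule sets.Int)
    then have "T n d \<in> mu_measurable \<mu>" by simp
    from measurable_sigma_closed[OF this] obtain \<C> where
      props: "countable \<C> \<and> (\<forall>C\<in>\<C>. closed C \<and> C \<subseteq> T n d) \<and> \<mu> (T n d - \<Union>\<C>) = 0" ..
    have \<C>: "countable \<C>" "\<And>C. C \<in> \<C> \<Longrightarrow> closed C" "\<And>C. C \<in> \<C> \<Longrightarrow> C \<subseteq> T n d" "\<mu> (T n d - \<Union>\<C>) = 0"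
      using props by simp_all
    define N where "N C = {x \<in> C. x islimpt UNIV \<and> (\<nexists>P \<Gamma> B F. branches_at D Q f C x P \<Gamma> B F)}" for C
    have "\<mu> (N C) = 0" if "C \<in> \<C>" for C
      unfolding N_def
    proof (rule branches_ae[OF D \<C>(2)[OF that] f])
      show "Gdist (f x) (f y) \<le> 3 * real n * dist x y" if "x \<in> C" "y \<in> C" for x y
        using that \<C>(3)[OF \<open>C \<in> \<C>\<close>] by (intro lip) auto
    qed simp
    then have "\<mu> (\<Union>C\<in>\<C>. N C) = 0" using \<C>(1) by (intro null_UN)
    from null_Un[OF this \<C>(4)] show ?thesis
    proof (rule null_subset[rotated], intro subsetI)
      fix x assume x: "x \<in> {x \<in> T n d. \<not> ?P x}"
      then have "mu_accum \<mu> UNIV x" using E(1) by (auto simp: T_def A_set_mu_def)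
      then have acc: "x islimpt UNIV" by (rule mu_accum_islimpt)
      have "x \<in> N C" if "C \<in> \<C>" "x \<in> C" for C
        using approx_differentiable_from_branches[OF XD f acc] x acc that(2) by (auto simp: N_def)
      then show "x \<in> (\<Union>C\<in>\<C>. N C) \<union> (T n d - \<Union>\<C>)" using x by blast
    qed
  qed
  have "\<mu> (\<Union>n. \<Union>d\<in>Z. {x \<in> T n d. \<not> ?P x}) = 0" using Z(1) null by (intro null_UN) auto
  moreover have "{x \<in> E. \<not> ?P x} \<subseteq> (\<Union>n. \<Union>d\<in>Z. {x \<in> T n d. \<not> ?P x})"
  proof
    fix x assume x: "x \<in> {x \<in> E. \<not> ?P x}"
    then obtain n where n: "approx_lipschitz_at f x (real n) (R n)"
      using A_set_mu_approx_lipschitz[where f = f and Q = Q and x = x, OF f] E(1) by (auto simp: R_def)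
    obtain d where d: "d \<in> Z" "d \<in> ball x (R n / 5)" using Z(2)[of "ball x (R n / 5)"] R[of n] by auto
    have "x \<in> S n d" using n d(2) by (auto simp: S_def dist_commute)
    then have "x \<in> T n d" using x closure_subset by (auto simp: T_def)
    then show "x \<in> (\<Union>n. \<Union>d\<in>Z. {x \<in> T n d. \<not> ?P x})" using x d(1) by blast
  qed
  ultimately show "\<mu> {x \<in> E. \<not> ?P x} = 0" by (rule null_subset[rotated])
qed

end

theorem theorem3p4:
  fixes K :: real and \<mu> :: "'x::polish_space set \<Rightarrow> ennreal" and Q :: nat
    and D :: "('x \<times> 'm::{metric_space, complete_space} \<times> ('x set \<times> ('x \<Rightarrow> 'm)) set) set"
  assumes "doubling_mms K \<mu>" and "Q \<ge> 1"
  shows "(X_distribution UNIV dist D \<and> differentiably_complete \<mu> D \<longrightarrow>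
            (\<forall>f :: 'x \<Rightarrow> 'm multiset. (\<forall>x. f x \<in> AQ Q) \<longrightarrow>
               ae_on \<mu> (A_set Gdist UNIV f) (E_differentiable (DQ Q D) Gdist UNIV f)))
       \<and> (approx_X_distribution \<mu> UNIV dist D \<and> differentiably_complete \<mu> D \<longrightarrow>
            (\<forall>f :: 'x \<Rightarrow> 'm multiset. (\<forall>x. f x \<in> AQ Q) \<longrightarrow>
               ae_on \<mu> (A_set_mu \<mu> Gdist UNIV f) (approx_E_differentiable \<mu> (DQ_approx \<mu> Q D) Gdist UNIV f)))"
proof -
  interpret doubling_space K \<mu> by unfold_locales (rule assms(1))
  show ?thesis using ae_differentiable ae_approx_differentiable by blast
qed

end
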